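(* Fix an integer $d\geq3$, and let $\lambda(d,\xi)$ be the set-to-set distance exponent of $d$-dimensional Liouville first passage percolation. For each $\gamma\in(0,\sqrt{2d})$, there exists a unique $\mathsf d_\gamma\in(0,\infty)$ such that $$\lambda(d,\xi)=1-\xi Q\quad\text{for}\quad \xi=\frac{\gamma}{\mathsf d_\gamma}\ \text{ and }\ Q=\frac{d}{\gamma}+\frac{\gamma}{2}.$$ Moreover, as functions of $\gamma$, both $\xi=\gamma/\mathsf d_\gamma$ and $\mathsf d_\gamma$ are continuous and strictly increasing on $(0,\sqrt{2d})$.
   Context: Log-correlated field. For $d\ge 2$, let $h$ be the whole-space log-correlated Gaussian field (LGF) on $\mathbb{R}^d$: the centered Gaussian random generalized function, a priori defined modulo additive constant, with $\mathrm{Cov}[(h,f_1),(h,f_2)] = \int_{\mathbb{R}^d\times\mathbb{R}^d} f_1(x)f_2(y)\log\frac{1}{|x-y|}\,dx\,dy$ for Schwartz functions $f_1,f_2$ with average $0$. The additive constant is fixed by requiring the average of $h$ over the unit sphere to be $0$. Equivalently, with $\sigma$ the uniform probability measure on the unit sphere, for a suitable probability measure $\mu$ (one with finite logarithmic energy) the variable $(h,\mu)$ is interpreted as $(h,\mu-\sigma)$, where the covariance formula above extends to signed measures of total mass $0$ with finite logarithmic energy. Mollification. For $\epsilon>0$ and $x\in\mathbb{R}^d$, $h_\epsilon(x)$ is the average of $h$ over the box $x+[-\epsilon,\epsilon]^d$. LFPP. For $\xi\ge 0$ and a discrete (nearest-neighbor) path $P:\{1,\dots,N\}\to\epsilon\mathbb{Z}^d$,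 set $L_h^{\epsilon,\xi}(P) := \sum_{i=1}^N \epsilon\, e^{\xi h_\epsilon(P(i))}$. For $A\subset\epsilon\mathbb{Z}^d$ and $z,w\in A$, let $D_h^{\epsilon,\xi}(z,w;A)$ be the infimum of $L_h^{\epsilon,\xi}(P)$ over discrete paths $P$ from $z$ to $w$ staying in $A$; for sets $U,V\subset A$, $D_h^{\epsilon,\xi}(U,V;A)$ is the infimum over $z\in U$, $w\in V$. Distance exponent. Let $S^\epsilon=[0,1]^d\cap\epsilon\mathbb{Z}^d$, $\partial_L S^\epsilon = (\{0\}\times[0,1]^{d-1})\cap\epsilon\mathbb{Z}^d$, $\partial_R S^\epsilon = (\{1\}\times[0,1]^{d-1})\cap\epsilon\mathbb{Z}^d$. Define $$\lambda(d,\xi) := \sup\left\{\alpha\in\mathbb{R} : \liminf_{\epsilon\to0}\mathbb{P}\left[D_h^{\epsilon,\xi}(\partial_L S^\epsilon,\partial_R S^\epsilon;S^\epsilon)\leq\epsilon^\alpha\right]=1\right\},$$ where $\epsilon\to0$ along values with $\epsilon^{-1}\in\mathbb{N}$. *)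

theory Defs
  imports "HOL-Probability.Probability"
begin

text \<open>
  A signed measure on \<open>\<real>\<^sup>d\<close> is represented by a pair \<open>(\<mu>, \<nu>)\<close> of finite Borel measures, standing for
  \<open>\<mu> - \<nu>\<close>. The pair need not be the Jordan decomposition. If two pairs have the same difference, the
  covariance formula below forces the corresponding values of the field to agree almost surely.
\<close>

type_synonym 'a signed_pair = "'a measure \<times> 'a measure"

text \<open>
  The kernel is infinite on the diagonal, whereas \<open>ln 0 = 0\<close> in HOL; without the case distinction
  measures with atoms would have finite energy.
\<close>

definition abs_log_energy :: "'a::euclidean_space measure \<Rightarrow> 'a measure \<Rightarrow> ennreal" where
  "abs_log_energy \<mu> \<nu> =
     (\<integral>\<^sup>+ p. (if fst p = snd p then \<infinity> else ennreal \<bar>ln (dist (fst p) (snd p))\<bar>) \<partial>(\<mu> \<Otimes>\<^sub>M \<nu>))"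

definition mass_zero_finite_energy :: "'a::euclidean_space signed_pair set" where
  "mass_zero_finite_energy = {(\<mu>, \<nu>).
     finite_measure \<mu> \<and> sets \<mu> = sets borel \<and>
     finite_measure \<nu> \<and> sets \<nu> = sets borel \<and>
     measure \<mu> UNIV = measure \<nu> UNIV \<and>
     (\<forall>\<alpha>\<in>{\<mu>, \<nu>}. \<forall>\<beta>\<in>{\<mu>, \<nu>}. abs_log_energy \<alpha> \<beta> < \<infinity>)}"

definition log_energy :: "'a::euclidean_space measure \<Rightarrow> 'a measure \<Rightarrow> real" where
  "log_energy \<mu> \<nu> = (\<integral>p. ln (1 / dist (fst p) (snd p)) \<partial>(\<mu> \<Otimes>\<^sub>M \<nu>))"

definition log_covariance :: "'a::euclidean_space signed_pair \<Rightarrow> 'a signed_pair \<Rightarrow> real" where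
  "log_covariance \<rho> \<rho>' =
     log_energy (fst \<rho>) (fst \<rho>') - log_energy (fst \<rho>) (snd \<rho>')
     - log_energy (snd \<rho>) (fst \<rho>') + log_energy (snd \<rho>) (snd \<rho>')"

text \<open>Degenerate (almost surely zero) Gaussians are allowed.\<close>

definition centered_gaussian :: "'w measure \<Rightarrow> ('w \<Rightarrow> real) \<Rightarrow> bool" where
  "centered_gaussian M X \<longleftrightarrow> X \<in> borel_measurable M \<and>
     ((AE \<omega> in M. X \<omega> = 0) \<or> (\<exists>s>0. distributed M lborel X (\<lambda>x. ennreal (normal_density 0 s x))))"

text \<open>
  The whole-space log-correlated Gaussian field, modulo additive constant: a centered Gaussian
  process \<open>\<rho> \<mapsto> (h, \<rho>)\<close> indexed by the signed measures of total mass zero and finite logarithmic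
  energy. A Schwartz function \<open>f\<close> of average zero is the index \<open>(f\<^sup>+ dx, f\<^sup>- dx)\<close>.
\<close>

definition log_correlated_field ::
  "'w measure \<Rightarrow> ('a::euclidean_space signed_pair \<Rightarrow> 'w \<Rightarrow> real) \<Rightarrow> bool" where
  "log_correlated_field M h \<longleftrightarrow> prob_space M \<and>
     (\<forall>F c. finite F \<and> F \<subseteq> mass_zero_finite_energy \<longrightarrow>
        centered_gaussian M (\<lambda>\<omega>. \<Sum>\<rho>\<in>F. c \<rho> * h \<rho> \<omega>)) \<and>
     (\<forall>\<rho>\<in>mass_zero_finite_energy. \<forall>\<rho>'\<in>mass_zero_finite_energy.
        (\<integral>\<omega>. h \<rho> \<omega> * h \<rho>' \<omega> \<partial>M) = log_covariance \<rho> \<rho>')"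

text \<open>
  The uniform distribution on the unit sphere is the law of \<open>X / |X|\<close> for \<open>X\<close> uniform on the unit ball.
\<close>

definition uniform_sphere :: "'a::euclidean_space measure" where
  "uniform_sphere = distr (uniform_measure lborel (ball 0 1)) borel sgn"

text \<open>
  The additive constant is fixed by making the average over the unit sphere zero, so that
  the average \<open>(h, \<mu>)\<close> against a probability measure \<open>\<mu>\<close> is \<open>(h, \<mu> - uniform_sphere)\<close>.
\<close>

definition box_average ::
  "((real ^ 'n) signed_pair \<Rightarrow> 'w \<Rightarrow> real) \<Rightarrow> real \<Rightarrow> 'w \<Rightarrow> real ^ 'n \<Rightarrow> real" where
  "box_average h \<epsilon> \<omega> x =
     h (uniform_measure lborel (cbox (x - vec \<epsilon>) (x + vec \<epsilon>)), uniform_sphere) \<omega>"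

definition lattice :: "real \<Rightarrow> (real ^ 'n) set" where
  "lattice \<epsilon> = {\<epsilon> *\<^sub>R x | x. \<forall>i. x $ i \<in> \<int>}"

definition lattice_paths ::
  "real \<Rightarrow> (real ^ 'n) set \<Rightarrow> real ^ 'n \<Rightarrow> real ^ 'n \<Rightarrow> (real ^ 'n) list set" where
  "lattice_paths \<epsilon> A z w = {P. P \<noteq> [] \<and> set P \<subseteq> A \<inter> lattice \<epsilon> \<and> hd P = z \<and> last P = w \<and>
     successively (\<lambda>x y. dist x y = \<epsilon>) P}"

text \<open>Below \<open>\<phi>\<close> is a realization of the mollified field \<open>h\<^sub>\<epsilon>\<close>.\<close>

definition lfpp_length :: "real \<Rightarrow> real \<Rightarrow> (real ^ 'n \<Rightarrow> real) \<Rightarrow> (real ^ 'n) list \<Rightarrow> real" where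
  "lfpp_length \<epsilon> \<xi> \<phi> P = (\<Sum>x\<leftarrow>P. \<epsilon> * exp (\<xi> * \<phi> x))"

definition lfpp_dist ::
  "real \<Rightarrow> real \<Rightarrow> (real ^ 'n \<Rightarrow> real) \<Rightarrow> (real ^ 'n) set \<Rightarrow> real ^ 'n \<Rightarrow> real ^ 'n \<Rightarrow> ennreal" where
  "lfpp_dist \<epsilon> \<xi> \<phi> A z w = (INF P\<in>lattice_paths \<epsilon> A z w. ennreal (lfpp_length \<epsilon> \<xi> \<phi> P))"

definition lfpp_set_dist ::
  "real \<Rightarrow> real \<Rightarrow> (real ^ 'n \<Rightarrow> real) \<Rightarrow> (real ^ 'n) set \<Rightarrow> (real ^ 'n) set \<Rightarrow> (real ^ 'n) set \<Rightarrow> ennreal"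
  where
  "lfpp_set_dist \<epsilon> \<xi> \<phi> A U V = (INF z\<in>U. INF w\<in>V. lfpp_dist \<epsilon> \<xi> \<phi> A z w)"

definition lattice_cube :: "real \<Rightarrow> (real ^ 'n) set" where
  "lattice_cube \<epsilon> = cbox 0 (vec 1) \<inter> lattice \<epsilon>"

text \<open>
  A finite index type has no distinguished first element, so the coordinate \<open>k\<close> in whose direction
  the cube is crossed is a parameter.
\<close>

definition left_face :: "'n \<Rightarrow> real \<Rightarrow> (real ^ 'n) set" where
  "left_face k \<epsilon> = {x \<in> lattice_cube \<epsilon>. x $ k = 0}"

definition right_face :: "'n \<Rightarrow> real \<Rightarrow> (real ^ 'n) set" where
  "right_face k \<epsilon> = {x \<in> lattice_cube \<epsilon>. x $ k = 1}"

text \<open>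
  The limit \<open>\<epsilon> \<rightarrow> 0\<close> is along \<open>\<epsilon> = 1/n\<close>. The supremum is taken in the extended reals, because the
  supremum of an empty or unbounded set of reals is a junk value in HOL.
\<close>

definition distance_exponent ::
  "'w measure \<Rightarrow> ((real ^ 'n) signed_pair \<Rightarrow> 'w \<Rightarrow> real) \<Rightarrow> 'n \<Rightarrow> real \<Rightarrow> ereal" where
  "distance_exponent M h k \<xi> = Sup {ereal \<alpha> | \<alpha>.
     liminf (\<lambda>n. let \<epsilon> = 1 / real n in ereal (measure M {\<omega> \<in> space M.
       lfpp_set_dist \<epsilon> \<xi> (box_average h \<epsilon> \<omega>) (lattice_cube \<epsilon>) (left_face k \<epsilon>) (right_face k \<epsilon>)
         \<le> ennreal (\<epsilon> powr \<alpha>)})) = 1}"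

end

theory Submission
  imports Defs "HOL-Real_Asymp.Real_Asymp"
begin

text \<open>
  Let \<open>s = sqrt (2 * d)\<close>, where \<open>d\<close> is the dimension. On \<open>(0, s)\<close> the function
  \<open>Q \<gamma> = d / \<gamma> + \<gamma> / 2\<close> decreases strictly from infinity towards \<open>Q s = s\<close>, and the relation
  between \<open>\<gamma>\<close> and \<open>\<xi> = \<gamma> / \<delta>\<close> says that \<open>(1 - \<lambda>(\<xi>)) / \<xi> = Q \<gamma>\<close>. Everything follows from three
  properties of the exponent \<open>\<lambda>\<close> on \<open>[0, \<infinity>)\<close>.

  \<^item> \<open>\<lambda>(0) = 0\<close>: for \<open>\<xi> = 0\<close> a path has length \<open>\<epsilon>\<close> times its number of points, and crossing the cube
    takes \<open>1 / \<epsilon> + 1\<close> points.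
  \<^item> \<open>\<lambda>\<close> is Lipschitz with constant \<open>s\<close> (\<open>crossing_exponent_lipschitz\<close>). The variance of the mollified
    field is at most \<open>ln (1 / \<epsilon>) + C\<close>, so by a union bound over the \<open>O(\<epsilon>\<^sup>-\<^sup>d)\<close> lattice points, for every \<open>c > s\<close>,
    its absolute value stays below \<open>c * ln (1 / \<epsilon>)\<close> with probability tending to one. Changing \<open>\<xi>\<close> to \<open>\<xi>'\<close> then changes all
    lengths by a factor of at most \<open>\<epsilon>\<close> to the power \<open>- c * \<bar>\<xi>' - \<xi>\<bar>\<close>.
  \<^item> \<open>\<lambda>(\<xi>) + \<xi>\<^sup>2 / 2\<close> is nondecreasing (\<open>crossing_exponent_rotation\<close>). For \<open>\<xi> < \<xi>'\<close> put \<open>a = \<xi> / \<xi>'\<close>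
    and \<open>b\<^sup>2 = 1 - a\<^sup>2\<close>. The field has the law of \<open>a * h\<^sub>1 + b * h\<^sub>2\<close> for independent copies \<open>h\<^sub>1\<close>, \<open>h\<^sub>2\<close>.
    A path that is short for \<open>h\<^sub>1\<close> with parameter \<open>\<xi>\<close> is chosen without looking at \<open>h\<^sub>2\<close>; averaging over
    \<open>h\<^sub>2\<close> multiplies its length by at most a constant times \<open>\<epsilon>\<close> to the power \<open>- (\<xi>'\<^sup>2 - \<xi>\<^sup>2) / 2\<close>.

  The deduction is \<open>exponent_relation_analysis\<close>. Since \<open>1 - \<lambda>\<close> grows at slope at most \<open>s\<close>, the ratio
  \<open>(1 - \<lambda>(\<xi>)) / \<xi>\<close> is strictly decreasing as long as it exceeds \<open>s\<close>; it tends to infinity at \<open>0\<close>, and it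
  is at most \<open>1 / \<xi> + s\<close>. So it takes each value \<open>Q \<gamma> > s\<close> exactly once, at a point \<open>\<xi>\<close> that increases
  with \<open>\<gamma>\<close>. The same slope bound shows that \<open>\<xi> * (Q \<gamma> - s)\<close> is nonincreasing in \<open>\<gamma>\<close>; a function that
  increases, but does not after multiplication by a continuous positive function, is continuous. The
  third property gives \<open>1 - \<lambda>(\<xi>) \<le> 1 + \<xi>\<^sup>2 / 2\<close>, which together with the slope bound forces \<open>\<delta> > 1\<close>. Once \<open>\<delta> > 1\<close> is known, the
  third property at two different parameters forces \<open>\<delta> = \<gamma> / \<xi>\<close> to be strictly increasing
  (\<open>dimension_strict\<close>).
\<close>

section \<open>From the distance exponent to the relation between \<open>\<gamma>\<close> and \<open>\<xi>\<close>\<close>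

text \<open>
  With \<open>q = (1 - lam x) / x\<close> and \<open>q'\<close> the same ratio at \<open>y\<close>, the slope bound \<open>s\<close> for \<open>1 - lam\<close> is the
  assertion that \<open>x * (q - s)\<close> does not increase. Hence the ratio strictly decreases while it is above \<open>s\<close>.
\<close>

lemma lipschitz_ratio_bound:
  fixes lam :: "real \<Rightarrow> real"
  assumes "\<And>x y. 0 \<le> x \<Longrightarrow> x \<le> y \<Longrightarrow> \<bar>lam y - lam x\<bar> \<le> s * (y - x)"
    and "0 < x" "x \<le> y" "1 - lam x = x * q" "1 - lam y = y * q'"
  shows "y * (q' - s) \<le> x * (q - s)"
proof -
  have "lam x - lam y \<le> s * (y - x)"
    using assms(1)[of x y] assms(2,3) by linarith
  then show ?thesis
    using assms(4,5) by (simp add: algebra_simps)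
qed

text \<open>
  The bracket \<open>x * (d / g + g / 2) - x\<^sup>2 / 2\<close> is \<open>1 - \<lambda>(x) - x\<^sup>2 / 2\<close> at the point \<open>x\<close> that belongs to \<open>g\<close>.
  In terms of \<open>t = x / g\<close>, the inverse dimension, it equals \<open>d * t + g\<^sup>2 / 2 * (t * (1 - t))\<close>. For \<open>0 < t < 1\<close>
  this is strictly increasing in \<open>g\<close>, and it is nondecreasing in \<open>t\<close> because \<open>g\<^sup>2 < 2 * d\<close>. As the bracket
  does not grow from \<open>g1\<close> to \<open>g2\<close>, the value of \<open>t\<close> must drop.
\<close>

lemma dimension_strict:
  fixes d x1 x2 g1 g2 :: real
  assumes d: "0 < d" and x: "0 < x1" "0 < x2" and g: "0 < g1" "g1 < g2" "g2\<^sup>2 < 2 * d"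
    and big: "x1 < g1" "x2 < g2"
    and comp: "x2 * (d / g2 + g2 / 2) - x2\<^sup>2 / 2 \<le> x1 * (d / g1 + g1 / 2) - x1\<^sup>2 / 2"
  shows "g1 / x1 < g2 / x2"
proof (rule ccontr)
  assume contra: "\<not> ?thesis"
  define t1 t2 where "t1 = x1 / g1" and "t2 = x2 / g2"
  have t: "0 < t1" "t1 < 1" "0 < t2" "t2 < 1"
    using x g big by (auto simp: t1_def t2_def)
  have "t1 \<le> t2"
    using contra x g by (simp add: t1_def t2_def field_simps)
  have e1: "x1 = t1 * g1" and e2: "x2 = t2 * g2"
    using g by (auto simp: t1_def t2_def)
  have "d * t1 + g1\<^sup>2 / 2 * (t1 * (1 - t1)) \<ge> d * t2 + g2\<^sup>2 / 2 * (t2 * (1 - t2))"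
  proof -
    have eq: "t * g * (d / g + g / 2) - (t * g)\<^sup>2 / 2 = d * t + g\<^sup>2 / 2 * (t * (1 - t))" if "0 < g" for t g :: real
      using that by (simp add: field_simps power2_eq_square)
    show ?thesis using comp g unfolding e1 e2 by (simp add: eq)
  qed
  moreover have "g1\<^sup>2 / 2 * (t1 * (1 - t1)) < g2\<^sup>2 / 2 * (t1 * (1 - t1))"
    using t g by (intro mult_strict_right_mono) (auto intro!: divide_strict_right_mono power_strict_mono)
  moreover have "d * t1 + g2\<^sup>2 / 2 * (t1 * (1 - t1)) \<le> d * t2 + g2\<^sup>2 / 2 * (t2 * (1 - t2))"
  proof -
    have "g2\<^sup>2 / 2 * (t1 + t2 - 1) \<le> d * 1"
    proof (cases "t1 + t2 - 1 \<ge> 0")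
      case True
      then show ?thesis using t g d by (intro mult_mono) auto
    next
      case False
      then have "g2\<^sup>2 / 2 * (t1 + t2 - 1) \<le> 0" by (intro mult_nonneg_nonpos) auto
      then show ?thesis using d by simp
    qed
    then have "0 \<le> (t2 - t1) * (d - g2\<^sup>2 / 2 * (t1 + t2 - 1))"
      using \<open>t1 \<le> t2\<close> by (intro mult_nonneg_nonneg) auto
    then show ?thesis by (simp add: field_simps power2_eq_square)
  qed
  ultimately show False by linarith
qed

lemma background_charge:
  fixes d \<gamma> :: real
  assumes "0 < \<gamma>" "0 \<le> d"
  shows "d / \<gamma> + \<gamma> / 2 - sqrt (2 * d) = (sqrt (2 * d) - \<gamma>)\<^sup>2 / (2 * \<gamma>)"
proof -
  have "(sqrt (2 * d))\<^sup>2 = 2 * d" using assms by simp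
  then show ?thesis
    using assms by (simp add: field_simps power2_eq_square)
qed

text \<open>
  Existence is the intermediate value theorem: \<open>1 - lam x - x * q\<close> is \<open>1\<close> at \<open>0\<close>, and it is bounded by
  \<open>1 - (q - s) * x\<close>. Uniqueness comes from \<open>lipschitz_ratio_bound\<close>.
\<close>

lemma exists_unique_crossing:
  fixes lam :: "real \<Rightarrow> real"
  assumes lip: "\<And>x y. 0 \<le> x \<Longrightarrow> x \<le> y \<Longrightarrow> \<bar>lam y - lam x\<bar> \<le> s * (y - x)"
    and zero: "lam 0 = 0" and q: "s < q"
  shows "\<exists>!x. 0 < x \<and> 1 - lam x = x * q"
proof (rule ex_ex1I)
  have s: "0 \<le> s" using lip[of 0 1] by auto
  define b where "b = 1 / (q - s)"
  have b: "0 < b" using q by (simp add: b_def)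
  have "continuous_on {0..b} lam"
  proof (rule lipschitz_on_continuous_on)
    show "s-lipschitz_on {0..b} lam"
    proof (rule lipschitz_onI)
      fix x y :: real assume "x \<in> {0..b}" "y \<in> {0..b}"
      then show "dist (lam x) (lam y) \<le> s * dist x y"
        using lip[of x y] lip[of y x] by (cases "x \<le> y") (auto simp: dist_real_def abs_minus_commute)
    qed (rule s)
  qed
  then have cont: "continuous_on {0..b} (\<lambda>x. 1 - lam x - x * q)"
    by (intro continuous_intros)
  have "1 - lam b - b * q \<le> 0"
  proof -
    have "1 - lam b - b * q \<le> 1 + s * b - b * q" using lip[of 0 b] b zero by auto
    also have "\<dots> = 0" using q by (simp add: b_def field_simps)
    finally show ?thesis .
  qed
  then obtain x where "0 \<le> x" "x \<le> b" "1 - lam x - x * q = 0"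
    using IVT2'[of "\<lambda>x. 1 - lam x - x * q" b 0 0] b zero cont by auto
  then show "\<exists>x. 0 < x \<and> 1 - lam x = x * q"
    using zero by (intro exI[of _ x]) (auto simp: less_le)
  have le_eq: "y \<le> x" if "0 < x" "1 - lam x = x * q" "0 < y" "1 - lam y = y * q" for x y
  proof (rule ccontr)
    assume "\<not> y \<le> x"
    then have "y * (q - s) \<le> x * (q - s)"
      using that by (intro lipschitz_ratio_bound[OF lip]) auto
    then show False using \<open>\<not> y \<le> x\<close> q by (simp add: mult_le_cancel_right)
  qed
  show "x = y" if "0 < x \<and> 1 - lam x = x * q" "0 < y \<and> 1 - lam y = y * q" for x y
    using le_eq[of x y] le_eq[of y x] that by (intro antisym) auto
qed

text \<open>
  The probabilistic input is reduced here to three properties of a real function. In the proof,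
  \<open>\<xi> \<gamma>\<close> is the solution that belongs to \<open>\<gamma>\<close>.
\<close>

lemma exponent_relation_analysis:
  fixes lam :: "real \<Rightarrow> real" and d :: real
  assumes d: "1 < d" and zero: "lam 0 = 0"
    and lip: "\<And>x y. 0 \<le> x \<Longrightarrow> x \<le> y \<Longrightarrow> \<bar>lam y - lam x\<bar> \<le> sqrt (2 * d) * (y - x)"
    and mono: "\<And>x y. 0 \<le> x \<Longrightarrow> x \<le> y \<Longrightarrow> lam x + x\<^sup>2 / 2 \<le> lam y + y\<^sup>2 / 2"
  defines "I \<equiv> {0 <..< sqrt (2 * d)}"
    and "Q \<equiv> \<lambda>\<gamma>. d / \<gamma> + \<gamma> / 2"
  shows "\<And>\<gamma>. \<gamma> \<in> I \<Longrightarrow> \<exists>!\<delta>. 0 < \<delta> \<and> lam (\<gamma> / \<delta>) = 1 - \<gamma> / \<delta> * Q \<gamma>"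
    and "\<And>D. (\<And>\<gamma>. \<gamma> \<in> I \<Longrightarrow> 0 < D \<gamma> \<and> lam (\<gamma> / D \<gamma>) = 1 - \<gamma> / D \<gamma> * Q \<gamma>) \<Longrightarrow>
            continuous_on I (\<lambda>\<gamma>. \<gamma> / D \<gamma>) \<and> strict_mono_on I (\<lambda>\<gamma>. \<gamma> / D \<gamma>) \<and>
            continuous_on I D \<and> strict_mono_on I D"
proof -
  define s where "s = sqrt (2 * d)"
  have s2: "s\<^sup>2 = 2 * d" and s: "0 < s" using d by (auto simp: s_def)
  have lip: "\<bar>lam y - lam x\<bar> \<le> s * (y - x)" if "0 \<le> x" "x \<le> y" for x y
    using lip[OF that] by (simp add: s_def)
  have I: "\<gamma> \<in> I \<longleftrightarrow> 0 < \<gamma> \<and> \<gamma> < s" for \<gamma> by (simp add: I_def s_def)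
  have Qs: "Q \<gamma> - s = (s - \<gamma>)\<^sup>2 / (2 * \<gamma>)" if "0 < \<gamma>" for \<gamma>
    using background_charge[OF that, of d] d by (simp add: Q_def s_def)
  have Qgt: "s < Q \<gamma>" if "\<gamma> \<in> I" for \<gamma>
  proof -
    have "0 < (s - \<gamma>)\<^sup>2 / (2 * \<gamma>)" using that by (auto simp: I)
    then have "0 < Q \<gamma> - s" using Qs[of \<gamma>] that by (simp only: I)
    then show ?thesis by simp
  qed
  show "\<exists>!\<delta>. 0 < \<delta> \<and> lam (\<gamma> / \<delta>) = 1 - \<gamma> / \<delta> * Q \<gamma>" if g: "\<gamma> \<in> I" for \<gamma>
  proof -
    have "\<exists>!x. 0 < x \<and> 1 - lam x = x * Q \<gamma>"
      by (rule exists_unique_crossing[of lam s]) (use lip zero Qgt[OF g] in auto)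
    then obtain x where x: "0 < x" "1 - lam x = x * Q \<gamma>"
      and uniq: "\<And>y. 0 < y \<Longrightarrow> 1 - lam y = y * Q \<gamma> \<Longrightarrow> y = x"
      by (elim ex1E conjE) blast
    have g0: "0 < \<gamma>" using g by (simp add: I)
    show ?thesis
    proof (rule ex1I[of _ "\<gamma> / x"])
      show "0 < \<gamma> / x \<and> lam (\<gamma> / (\<gamma> / x)) = 1 - \<gamma> / (\<gamma> / x) * Q \<gamma>"
        using x g0 by simp
    next
      fix \<delta> assume "0 < \<delta> \<and> lam (\<gamma> / \<delta>) = 1 - \<gamma> / \<delta> * Q \<gamma>"
      then have "0 < \<delta>" "1 - lam (\<gamma> / \<delta>) = \<gamma> / \<delta> * Q \<gamma>" by simp_all
      moreover from this have "\<gamma> / \<delta> = x" using g0 by (intro uniq) simp_all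
      ultimately show "\<delta> = \<gamma> / x" using g0 by auto
    qed
  qed
  fix D :: "real \<Rightarrow> real"
  assume D: "\<And>\<gamma>. \<gamma> \<in> I \<Longrightarrow> 0 < D \<gamma> \<and> lam (\<gamma> / D \<gamma>) = 1 - \<gamma> / D \<gamma> * Q \<gamma>"
  define \<xi> where "\<xi> = (\<lambda>\<gamma>. \<gamma> / D \<gamma>)"
  have xi: "0 < \<xi> \<gamma>" "1 - lam (\<xi> \<gamma>) = \<xi> \<gamma> * Q \<gamma>" if "\<gamma> \<in> I" for \<gamma>
    using D[OF that] that by (auto simp: \<xi>_def I)
  have Dxi: "D \<gamma> = \<gamma> / \<xi> \<gamma>" if "\<gamma> \<in> I" for \<gamma>
    using D[OF that] that by (auto simp: \<xi>_def I)
  have Qanti: "Q b < Q a" if "a \<in> I" "b \<in> I" "a < b" for a b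
  proof -
    have "(s - b)\<^sup>2 < (s - a)\<^sup>2" using that by (intro power_strict_mono) (auto simp: I)
    then have "(s - b)\<^sup>2 / (2 * b) < (s - a)\<^sup>2 / (2 * a)"
      using that by (intro frac_less) (auto simp: I)
    then show ?thesis using Qs[of a] Qs[of b] that by (auto simp: I)
  qed
  have xi_mono: "\<xi> a < \<xi> b" if "a \<in> I" "b \<in> I" "a < b" for a b
  proof (rule ccontr)
    assume "\<not> \<xi> a < \<xi> b"
    then have le: "\<xi> b \<le> \<xi> a" by simp
    have "\<xi> a * (Q a - s) \<le> \<xi> b * (Q b - s)"
      by (rule lipschitz_ratio_bound[of lam, OF lip]) (use xi that le in auto)
    also have "\<dots> \<le> \<xi> a * (Q b - s)"
      using le Qgt[OF that(2)] by (intro mult_right_mono) auto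
    finally have "Q a \<le> Q b" using xi(1)[OF that(1)] by simp
    then show False using Qanti[OF that] by simp
  qed
  have xi_prod: "\<xi> b * (Q b - s) \<le> \<xi> a * (Q a - s)" if "a \<in> I" "b \<in> I" "a \<le> b" for a b
    by (rule lipschitz_ratio_bound[of lam, OF lip])
       (use xi that xi_mono[OF that(1,2)] in \<open>auto simp: le_less\<close>)
  \<comment> \<open>\<open>\<xi> b\<close> is squeezed between \<open>\<xi> a\<close> and \<open>\<xi> a * (Q a - s) / (Q b - s)\<close>.\<close>
  have xi_cont: "continuous_on I \<xi>"
    unfolding continuous_on_def
  proof
    fix a assume a: "a \<in> I"
    have bound: "\<bar>\<xi> b - \<xi> a\<bar> \<le> \<bar>\<xi> a * ((Q a - s) / (Q b - s)) - \<xi> a\<bar>" if b: "b \<in> I" for b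
    proof (cases "a \<le> b")
      case True
      have "\<xi> b \<le> \<xi> a * ((Q a - s) / (Q b - s))"
        using xi_prod[OF a b True] Qgt[OF b] by (simp add: field_simps)
      moreover have "\<xi> a \<le> \<xi> b" using xi_mono[OF a b] True by (cases "a = b") auto
      ultimately show ?thesis by linarith
    next
      case False
      have "\<xi> a * ((Q a - s) / (Q b - s)) \<le> \<xi> b"
        using xi_prod[OF b a] False Qgt[OF b] by (simp add: field_simps)
      moreover have "\<xi> b < \<xi> a" using xi_mono[OF b a] False by simp
      ultimately show ?thesis by linarith
    qed
    have "((\<lambda>b. \<xi> a * ((Q a - s) / (Q b - s)) - \<xi> a) \<longlongrightarrow> \<xi> a * ((Q a - s) / (Q a - s)) - \<xi> a) (at a within I)"
      unfolding Q_def using Qgt[OF a] a by (intro tendsto_intros) (auto simp: Q_def I)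
    then have "((\<lambda>b. \<xi> a * ((Q a - s) / (Q b - s)) - \<xi> a) \<longlongrightarrow> 0) (at a within I)"
      using Qgt[OF a] by simp
    then have "((\<lambda>b. \<xi> b - \<xi> a) \<longlongrightarrow> 0) (at a within I)"
      by (rule Lim_null_comparison[rotated, OF tendsto_rabs_zero])
         (use bound in \<open>auto simp: eventually_at_filter\<close>)
    then show "(\<xi> \<longlongrightarrow> \<xi> a) (at a within I)"
      by (simp add: LIM_zero_iff)
  qed
  \<comment> \<open>The quadratic bound gives ratio at most \<open>sqrt 2\<close> at \<open>sqrt 2\<close>, and the slope bound keeps it at most \<open>s\<close>
    from there on. So the solutions lie in \<open>(0, sqrt 2)\<close>, where \<open>x \<mapsto> 1 / x + x / 2\<close> is decreasing;
    this excludes \<open>a \<le> \<xi> a\<close>.\<close>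
  have up: "1 - lam x \<le> 1 + x\<^sup>2 / 2" if "0 \<le> x" for x
    using mono[of 0 x] that zero by simp
  have small: "\<xi> a < a" if a: "a \<in> I" for a
  proof -
    define x where "x = \<xi> a"
    have x: "0 < x" "1 - lam x = x * Q a" using xi[OF a] by (auto simp: x_def)
    have "x < sqrt 2"
    proof (rule ccontr)
      assume "\<not> x < sqrt 2"
      then have ge: "sqrt 2 \<le> x" by simp
      have "x * s < x * Q a" using Qgt[OF a] x by simp
      also have "\<dots> \<le> 1 - lam (sqrt 2) + s * (x - sqrt 2)"
        using lip[of "sqrt 2" x] ge x by auto
      also have "\<dots> \<le> 2 + s * (x - sqrt 2)"
        using up[of "sqrt 2"] by simp
      finally have "s * sqrt 2 < 2" by (simp add: algebra_simps)
      moreover have "sqrt 2 * sqrt 2 \<le> s * sqrt 2"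
        using d by (intro mult_right_mono) (auto simp: s_def)
      ultimately show False by simp
    qed
    then have x2: "x\<^sup>2 < 2" using x by (metis abs_of_pos real_sqrt_abs real_sqrt_less_iff)
    show ?thesis
    proof (rule ccontr)
      assume "\<not> \<xi> a < a"
      then have le: "a \<le> x" by (simp add: x_def)
      have a0: "0 < a" using a by (simp add: I)
      have "x * (d / a + a / 2) \<le> 1 + x\<^sup>2 / 2"
        using x up[of x] by (simp add: Q_def)
      moreover have "x * (1 / a + a / 2) < x * (d / a + a / 2)"
        using d a0 x by (intro mult_strict_left_mono) (auto simp: divide_strict_right_mono)
      ultimately have "x * (1 / a + a / 2) < 1 + x\<^sup>2 / 2" by linarith
      then have "(x - a) * (2 - x * a) < 0" using a0 by (simp add: field_simps power2_eq_square)
      moreover have "x * a \<le> x * x" using le x by simp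
      ultimately show False using x2 le
        by (auto simp: mult_less_0_iff power2_eq_square)
    qed
  qed
  have D_mono: "D a < D b" if "a \<in> I" "b \<in> I" "a < b" for a b
  proof -
    have "a / \<xi> a < b / \<xi> b"
    proof (rule dimension_strict[of d])
      show "b\<^sup>2 < 2 * d" using that(2) unfolding s2[symmetric] by (intro power_strict_mono) (auto simp: I)
      have "lam (\<xi> a) + (\<xi> a)\<^sup>2 / 2 \<le> lam (\<xi> b) + (\<xi> b)\<^sup>2 / 2"
        using xi(1)[OF that(1)] xi_mono[OF that] by (intro mono) auto
      then show "\<xi> b * (d / b + b / 2) - (\<xi> b)\<^sup>2 / 2 \<le> \<xi> a * (d / a + a / 2) - (\<xi> a)\<^sup>2 / 2"
        using xi(2)[OF that(1)] xi(2)[OF that(2)] by (simp add: Q_def)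
    qed (use that small xi(1) d in \<open>auto simp: I\<close>)
    then show ?thesis using Dxi that by simp
  qed
  have "continuous_on I (\<lambda>\<gamma>. \<gamma> / \<xi> \<gamma>)"
  proof -
    have "\<forall>\<gamma>\<in>I. \<xi> \<gamma> \<noteq> 0" using xi(1) by fastforce
    then show ?thesis using xi_cont by (intro continuous_intros)
  qed
  then have "continuous_on I D"
    using Dxi by (simp cong: continuous_on_cong)
  then show "continuous_on I (\<lambda>\<gamma>. \<gamma> / D \<gamma>) \<and> strict_mono_on I (\<lambda>\<gamma>. \<gamma> / D \<gamma>) \<and>
            continuous_on I D \<and> strict_mono_on I D"
    using xi_cont xi_mono D_mono unfolding \<xi>_def by (auto intro!: strict_mono_onI)
qed

section \<open>Joint laws are determined by linear combinations\<close>

text \<open>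
  Levy's uniqueness theorem for the image of \<open>u M\<close> under \<open>X\<close>. The weight \<open>u\<close> is arbitrary, nonnegative and
  bounded, so that further variables can be stored in it; a weight of total mass zero vanishes almost
  surely and has to be treated apart, since it cannot be normalized.
\<close>

lemma weighted_char_uniqueness:
  fixes u X :: "'a \<Rightarrow> real" and v Y :: "'b \<Rightarrow> real"
  assumes M: "prob_space M" and N: "prob_space N"
    and [measurable]: "u \<in> borel_measurable M" "X \<in> borel_measurable M"
      "v \<in> borel_measurable N" "Y \<in> borel_measurable N"
    and u: "\<And>\<omega>. 0 \<le> u \<omega>" "\<And>\<omega>. u \<omega> \<le> b" and v: "\<And>\<omega>. 0 \<le> v \<omega>" "\<And>\<omega>. v \<omega> \<le> b"
    and eq: "\<And>t. (\<integral>\<omega>. u \<omega> *\<^sub>R iexp (t * X \<omega>) \<partial>M) = (\<integral>\<omega>. v \<omega> *\<^sub>R iexp (t * Y \<omega>) \<partial>N)"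
    and A [measurable]: "A \<in> sets borel"
  shows "(\<integral>\<omega>. u \<omega> * indicator A (X \<omega>) \<partial>M) = (\<integral>\<omega>. v \<omega> * indicator A (Y \<omega>) \<partial>N)"
proof -
  interpret M: prob_space M by fact
  interpret N: prob_space N by fact
  have iu: "integrable M u" by (rule M.integrable_const_bound[of _ b]) (use u in auto)
  have iv: "integrable N v" by (rule N.integrable_const_bound[of _ b]) (use v in auto)
  define m where "m = (\<integral>\<omega>. u \<omega> \<partial>M)"
  have "complex_of_real (\<integral>\<omega>. u \<omega> \<partial>M) = complex_of_real (\<integral>\<omega>. v \<omega> \<partial>N)"
    using eq[of 0] by (simp add: scaleR_conv_of_real integral_complex_of_real)
  then have mv: "m = (\<integral>\<omega>. v \<omega> \<partial>N)" by (simp add: m_def)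
  show ?thesis
  proof (cases "m = 0")
    case True
    then have "AE \<omega> in M. u \<omega> = 0" "AE \<omega> in N. v \<omega> = 0"
      using integral_nonneg_eq_0_iff_AE[OF iu] integral_nonneg_eq_0_iff_AE[OF iv] u v mv
      by (auto simp: m_def)
    then have "AE \<omega> in M. u \<omega> * indicator A (X \<omega>) = 0" "AE \<omega> in N. v \<omega> * indicator A (Y \<omega>) = 0"
      by auto
    then show ?thesis by (simp add: integral_eq_zero_AE)
  next
    case False
    then have m: "0 < m" using u(1) by (simp add: m_def less_le integral_nonneg)
    have law: "real_distribution (distr (density L (\<lambda>\<omega>. ennreal (w \<omega> / m))) borel Z) \<and>
        char (distr (density L (\<lambda>\<omega>. ennreal (w \<omega> / m))) borel Z) t = (\<integral>\<omega>. w \<omega> *\<^sub>R iexp (t * Z \<omega>) \<partial>L) /\<^sub>R m \<and>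
        measure (distr (density L (\<lambda>\<omega>. ennreal (w \<omega> / m))) borel Z) A = (\<integral>\<omega>. w \<omega> * indicator A (Z \<omega>) \<partial>L) / m"
      if L: "prob_space L" and [measurable]: "w \<in> borel_measurable L" "Z \<in> borel_measurable L"
        and w: "\<And>\<omega>. 0 \<le> w \<omega>" "integrable L w" "(\<integral>\<omega>. w \<omega> \<partial>L) = m"
      for L :: "'z measure" and w Z t
    proof -
      interpret L: prob_space L by fact
      let ?D = "density L (\<lambda>\<omega>. ennreal (w \<omega> / m))"
      have "emeasure ?D (space ?D) = (\<integral>\<^sup>+\<omega>. ennreal (w \<omega> / m) \<partial>L)"
        by (simp add: emeasure_density cong: nn_integral_cong)
      also have "\<dots> = ennreal (\<integral>\<omega>. w \<omega> / m \<partial>L)"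
        using w m by (intro nn_integral_eq_integral) auto
      also have "\<dots> = 1" using w m by simp
      finally interpret D: prob_space ?D by (rule prob_spaceI)
      interpret DD: prob_space "distr ?D borel Z" by (rule D.prob_space_distr) simp
      have 1: "real_distribution (distr ?D borel Z)"
        by (rule D.real_distribution_distr) simp
      have 2: "char (distr ?D borel Z) t = (\<integral>\<omega>. w \<omega> *\<^sub>R iexp (t * Z \<omega>) \<partial>L) /\<^sub>R m"
        unfolding char_def
        using w m by (subst integral_distr; (subst integral_density)?) (auto simp: divide_inverse_commute simp flip: scaleR_scaleR)
      have "measure (distr ?D borel Z) A = (\<integral>x. indicator A x \<partial>distr ?D borel Z)" by simp
      also have "\<dots> = (\<integral>\<omega>. (w \<omega> / m) *\<^sub>R indicator A (Z \<omega>) \<partial>L)"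
        using w m by (subst integral_distr; (subst integral_density)?) auto
      also have "\<dots> = (\<integral>\<omega>. w \<omega> * indicator A (Z \<omega>) \<partial>L) / m" by simp
      finally show ?thesis using 1 2 by blast
    qed
    note lawM = law[OF M \<open>u \<in> _\<close> \<open>X \<in> _\<close> u(1) iu m_def[symmetric]]
    note lawN = law[OF N \<open>v \<in> _\<close> \<open>Y \<in> _\<close> v(1) iv mv[symmetric]]
    have "distr (density M (\<lambda>\<omega>. ennreal (u \<omega> / m))) borel X = distr (density N (\<lambda>\<omega>. ennreal (v \<omega> / m))) borel Y"
    proof (rule Levy_uniqueness)
      show "char (distr (density M (\<lambda>\<omega>. ennreal (u \<omega> / m))) borel X) =
          char (distr (density N (\<lambda>\<omega>. ennreal (v \<omega> / m))) borel Y)"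
      proof
        fix t show "char (distr (density M (\<lambda>\<omega>. ennreal (u \<omega> / m))) borel X) t =
          char (distr (density N (\<lambda>\<omega>. ennreal (v \<omega> / m))) borel Y) t"
          using lawM[of t] lawN[of t] eq[of t] by simp
      qed
    qed (use lawM lawN in auto)
    then show ?thesis using lawM lawN m by auto
  qed
qed

text \<open>
  One variable at a time, an exponential \<open>iexp (t * X)\<close> is traded for an indicator of \<open>X\<close>, while the
  exponential of the remaining variables is kept. The latter is not a nonnegative weight; \<open>1 + cos \<theta>\<close> and
  \<open>1 + sin \<theta>\<close> are, and they are combinations of \<open>iexp (a * \<theta>)\<close> with \<open>a\<close> in \<open>{-1, 0, 1}\<close>.
\<close>

lemma indicator_iexp_uniqueness:
  fixes U X \<theta> :: "'a \<Rightarrow> real" and V Y \<eta> :: "'b \<Rightarrow> real"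
  assumes M: "prob_space M" and N: "prob_space N"
    and [measurable]: "U \<in> borel_measurable M" "X \<in> borel_measurable M" "\<theta> \<in> borel_measurable M"
      "V \<in> borel_measurable N" "Y \<in> borel_measurable N" "\<eta> \<in> borel_measurable N"
    and U: "\<And>\<omega>. 0 \<le> U \<omega>" "\<And>\<omega>. U \<omega> \<le> 1" and V: "\<And>\<omega>. 0 \<le> V \<omega>" "\<And>\<omega>. V \<omega> \<le> 1"
    and eq: "\<And>a t. (\<integral>\<omega>. U \<omega> *\<^sub>R iexp (a * \<theta> \<omega> + t * X \<omega>) \<partial>M) = (\<integral>\<omega>. V \<omega> *\<^sub>R iexp (a * \<eta> \<omega> + t * Y \<omega>) \<partial>N)"
    and A [measurable]: "A \<in> sets borel"
  shows "(\<integral>\<omega>. (U \<omega> * indicator A (X \<omega>)) *\<^sub>R iexp (\<theta> \<omega>) \<partial>M) = (\<integral>\<omega>. (V \<omega> * indicator A (Y \<omega>)) *\<^sub>R iexp (\<eta> \<omega>) \<partial>N)"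
proof -
  have expand: "integrable L (\<lambda>\<omega>. W \<omega> * f (\<zeta> \<omega>) * indicator A (Z \<omega>)) \<and>
      integrable L (\<lambda>\<omega>. W \<omega> *\<^sub>R iexp (c * \<zeta> \<omega> + t * Z \<omega>))"
    if L: "prob_space L" and [measurable]: "W \<in> borel_measurable L" "Z \<in> borel_measurable L" "\<zeta> \<in> borel_measurable L"
      and W: "\<And>\<omega>. 0 \<le> W \<omega>" "\<And>\<omega>. W \<omega> \<le> 1"
      and f: "f \<in> borel_measurable borel" "\<And>x. \<bar>f x\<bar> \<le> 1"
    for L :: "'z measure" and W Z \<zeta> c t and f :: "real \<Rightarrow> real"
  proof -
    interpret L: prob_space L by fact
    note f(1)[measurable]
    have "\<bar>W \<omega> * f (\<zeta> \<omega>) * indicator A (Z \<omega>)\<bar> \<le> 1" for \<omega>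
      using W[of \<omega>] f(2)[of "\<zeta> \<omega>"] by (auto simp: abs_mult indicator_def intro!: mult_le_one)
    then show ?thesis
      using W by (intro conjI L.integrable_const_bound[of _ 1]) (auto simp: norm_exp_i_times)
  qed
  note intM = expand[OF M \<open>U \<in> _\<close> \<open>X \<in> _\<close> \<open>\<theta> \<in> _\<close> U, THEN conjunct1]
    and intN = expand[OF N \<open>V \<in> _\<close> \<open>Y \<in> _\<close> \<open>\<eta> \<in> _\<close> V, THEN conjunct1]
  have expM: "integrable M (\<lambda>\<omega>. U \<omega> *\<^sub>R iexp (c * \<theta> \<omega> + t * X \<omega>))"
    and expN: "integrable N (\<lambda>\<omega>. V \<omega> *\<^sub>R iexp (c * \<eta> \<omega> + t * Y \<omega>))" for c t
    using expand[OF M \<open>U \<in> _\<close> \<open>X \<in> _\<close> \<open>\<theta> \<in> _\<close> U, of "\<lambda>_. 0"]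
      expand[OF N \<open>V \<in> _\<close> \<open>Y \<in> _\<close> \<open>\<eta> \<in> _\<close> V, of "\<lambda>_. 0"] by simp_all
  have lin_int: "(\<integral>\<omega>. f \<omega> + (p * g \<omega> + q * h \<omega>) \<partial>L) = (\<integral>\<omega>. f \<omega> \<partial>L) + (p * (\<integral>\<omega>. g \<omega> \<partial>L) + q * (\<integral>\<omega>. h \<omega> \<partial>L))"
    if "integrable L f" "integrable L g" "integrable L h" for L :: "'z measure" and f g h and p q :: complex
    using that by simp
  have trig: "iexp (1 * a + b) + iexp (- 1 * a + b) = 2 * (complex_of_real (cos a) * iexp b)"
    "iexp (1 * a + b) - iexp (- 1 * a + b) = 2 * \<i> * (complex_of_real (sin a) * iexp b)" for a b :: real
    by (simp_all add: complex_eq_iff Re_exp Im_exp cos_add sin_add cos_diff sin_diff)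
  have distr_scale: "(w * (1 + r)) *\<^sub>R e = w *\<^sub>R e + (p * (w *\<^sub>R e1) + q * (w *\<^sub>R e2))"
    if "complex_of_real r * e = p * e1 + q * e2" for w r :: real and e e1 e2 p q :: complex
  proof -
    have "(w * (1 + r)) *\<^sub>R e = w *\<^sub>R e + of_real w * (of_real r * e)"
      by (simp add: scaleR_conv_of_real algebra_simps)
    then show ?thesis unfolding that by (simp add: scaleR_conv_of_real algebra_simps)
  qed
  have weight: "(\<integral>\<omega>. (U \<omega> * (1 + f (\<theta> \<omega>))) * indicator A (X \<omega>) \<partial>M) =
      (\<integral>\<omega>. (V \<omega> * (1 + f (\<eta> \<omega>))) * indicator A (Y \<omega>) \<partial>N)"
    if f: "f \<in> borel_measurable borel" "\<And>x. \<bar>f x\<bar> \<le> 1"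
      and lin: "\<And>a b. complex_of_real (f a) * iexp b = p * iexp (1 * a + b) + q * iexp (- 1 * a + b)"
    for f :: "real \<Rightarrow> real" and p q :: complex
  proof (rule weighted_char_uniqueness[OF M N])
    note f(1)[measurable]
    show "(\<lambda>\<omega>. U \<omega> * (1 + f (\<theta> \<omega>))) \<in> borel_measurable M" "(\<lambda>\<omega>. V \<omega> * (1 + f (\<eta> \<omega>))) \<in> borel_measurable N"
      by measurable
    have f': "0 \<le> 1 + f x" "1 + f x \<le> 2" for x using f(2)[of x] by auto
    show "0 \<le> U \<omega> * (1 + f (\<theta> \<omega>))" "0 \<le> V \<omega>' * (1 + f (\<eta> \<omega>'))" for \<omega> \<omega>'
      using U V f' by auto
    show "U \<omega> * (1 + f (\<theta> \<omega>)) \<le> 2" "V \<omega>' * (1 + f (\<eta> \<omega>')) \<le> 2" for \<omega> \<omega>'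
      using mult_mono[of "U \<omega>" 1 "1 + f (\<theta> \<omega>)" 2] mult_mono[of "V \<omega>'" 1 "1 + f (\<eta> \<omega>')" 2]
        U V f' by auto
    fix t
    have split: "(w * (1 + f a)) *\<^sub>R iexp b = w *\<^sub>R iexp (0 * a + b) +
        (p * (w *\<^sub>R iexp (1 * a + b)) + q * (w *\<^sub>R iexp (- 1 * a + b)))" for w a b
      using distr_scale[OF lin[of a b], of w] by simp
    show "(\<integral>\<omega>. (U \<omega> * (1 + f (\<theta> \<omega>))) *\<^sub>R iexp (t * X \<omega>) \<partial>M) =
        (\<integral>\<omega>. (V \<omega> * (1 + f (\<eta> \<omega>))) *\<^sub>R iexp (t * Y \<omega>) \<partial>N)"
      unfolding split lin_int[OF expM expM expM] lin_int[OF expN expN expN] by (simp only: eq)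
  qed (use A in auto)
  have base: "(\<integral>\<omega>. U \<omega> * indicator A (X \<omega>) \<partial>M) = (\<integral>\<omega>. V \<omega> * indicator A (Y \<omega>) \<partial>N)"
    using weight[of "\<lambda>_. 0" 0 0] by simp
  have part: "(\<integral>\<omega>. U \<omega> * f (\<theta> \<omega>) * indicator A (X \<omega>) \<partial>M) = (\<integral>\<omega>. V \<omega> * f (\<eta> \<omega>) * indicator A (Y \<omega>) \<partial>N)"
    if f: "f \<in> borel_measurable borel" "\<And>x. \<bar>f x\<bar> \<le> 1"
      and lin: "\<And>a b. complex_of_real (f a) * iexp b = p * iexp (1 * a + b) + q * iexp (- 1 * a + b)"
    for f :: "real \<Rightarrow> real" and p q :: complex
  proof -
    have "(\<integral>\<omega>. (U \<omega> * (1 + f (\<theta> \<omega>))) * indicator A (X \<omega>) \<partial>M) =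
        (\<integral>\<omega>. U \<omega> * 1 * indicator A (X \<omega>) \<partial>M) + (\<integral>\<omega>. U \<omega> * f (\<theta> \<omega>) * indicator A (X \<omega>) \<partial>M)"
      by (subst Bochner_Integration.integral_add[symmetric])
        (use intM[OF f] intM[of "\<lambda>_. 1"] in \<open>simp_all add: distrib_left distrib_right\<close>)
    moreover have "(\<integral>\<omega>. (V \<omega> * (1 + f (\<eta> \<omega>))) * indicator A (Y \<omega>) \<partial>N) =
        (\<integral>\<omega>. V \<omega> * 1 * indicator A (Y \<omega>) \<partial>N) + (\<integral>\<omega>. V \<omega> * f (\<eta> \<omega>) * indicator A (Y \<omega>) \<partial>N)"
      by (subst Bochner_Integration.integral_add[symmetric])
        (use intN[OF f] intN[of "\<lambda>_. 1"] in \<open>simp_all add: distrib_left distrib_right\<close>)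
    ultimately show ?thesis using weight[OF f lin] base by simp
  qed
  have cs: "(\<integral>\<omega>. U \<omega> * cos (\<theta> \<omega>) * indicator A (X \<omega>) \<partial>M) = (\<integral>\<omega>. V \<omega> * cos (\<eta> \<omega>) * indicator A (Y \<omega>) \<partial>N)"
    by (rule part[of cos "1/2" "1/2"]) (use trig(1) in \<open>simp_all add: field_simps\<close>)
  have sn: "(\<integral>\<omega>. U \<omega> * sin (\<theta> \<omega>) * indicator A (X \<omega>) \<partial>M) = (\<integral>\<omega>. V \<omega> * sin (\<eta> \<omega>) * indicator A (Y \<omega>) \<partial>N)"
    by (rule part[of sin "1/(2*\<i>)" "- 1/(2*\<i>)"]) (use trig(2) in \<open>simp_all add: field_simps\<close>)
  have cart: "(w * i) *\<^sub>R iexp a = complex_of_real (w * cos a * i) + \<i> * complex_of_real (w * sin a * i)" for w i a :: real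
    by (simp add: complex_eq_iff Re_exp Im_exp)
  have combine: "(\<integral>\<omega>. complex_of_real (f \<omega>) + \<i> * complex_of_real (g \<omega>) \<partial>L) =
      complex_of_real (\<integral>\<omega>. f \<omega> \<partial>L) + \<i> * complex_of_real (\<integral>\<omega>. g \<omega> \<partial>L)"
    if "integrable L f" "integrable L g" for L :: "'z measure" and f g
    using that by simp
  have cs_int: "integrable M (\<lambda>\<omega>. U \<omega> * cos (\<theta> \<omega>) * indicator A (X \<omega>))" "integrable M (\<lambda>\<omega>. U \<omega> * sin (\<theta> \<omega>) * indicator A (X \<omega>))"
    "integrable N (\<lambda>\<omega>. V \<omega> * cos (\<eta> \<omega>) * indicator A (Y \<omega>))" "integrable N (\<lambda>\<omega>. V \<omega> * sin (\<eta> \<omega>) * indicator A (Y \<omega>))"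
    by (rule intM intN; simp)+
  show ?thesis
    unfolding cart combine[OF cs_int(1,2)] combine[OF cs_int(3,4)] cs sn ..
qed

text \<open>
  The Cramer-Wold device: the joint characteristic function determines the joint law. The fact \<open>mixed\<close>
  interpolates between the two: the variables in \<open>J\<close> enter through indicators and the others
  through the exponential. For \<open>J = I\<close> it is the equality of the two laws on rectangles.
\<close>

lemma cramer_wold:
  fixes X :: "'i \<Rightarrow> 'a \<Rightarrow> real" and Y :: "'i \<Rightarrow> 'b \<Rightarrow> real"
  assumes M: "prob_space M" and N: "prob_space N" and I: "finite I"
    and X: "\<And>i. i \<in> I \<Longrightarrow> X i \<in> borel_measurable M" and Y: "\<And>i. i \<in> I \<Longrightarrow> Y i \<in> borel_measurable N"
    and eq: "\<And>c. (\<integral>\<omega>. iexp (\<Sum>i\<in>I. c i * X i \<omega>) \<partial>M) = (\<integral>\<omega>. iexp (\<Sum>i\<in>I. c i * Y i \<omega>) \<partial>N)"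
  shows "distr M (Pi\<^sub>M I (\<lambda>_. borel)) (\<lambda>\<omega>. \<lambda>i\<in>I. X i \<omega>) = distr N (Pi\<^sub>M I (\<lambda>_. borel)) (\<lambda>\<omega>. \<lambda>i\<in>I. Y i \<omega>)"
proof -
  interpret M: prob_space M by fact
  interpret N: prob_space N by fact
  have mixed: "(\<integral>\<omega>. (\<Prod>j\<in>J. indicator (A j) (X j \<omega>)) *\<^sub>R iexp (\<Sum>i\<in>I-J. c i * X i \<omega>) \<partial>M) =
      (\<integral>\<omega>. (\<Prod>j\<in>J. indicator (A j) (Y j \<omega>)) *\<^sub>R iexp (\<Sum>i\<in>I-J. c i * Y i \<omega>) \<partial>N)"
    if "J \<subseteq> I" and A: "\<And>i. i \<in> I \<Longrightarrow> A i \<in> sets borel" for J c A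
    using finite_subset[OF \<open>J \<subseteq> I\<close> I] \<open>J \<subseteq> I\<close>
  proof (induction J arbitrary: c rule: finite_induct)
    case empty
    then show ?case using eq by simp
  next
    case (insert k J)
    have k: "k \<in> I" and J: "J \<subseteq> I" using insert by auto
    have bnd: "0 \<le> (\<Prod>j\<in>J. indicator (A j) (f j) :: real)" "(\<Prod>j\<in>J. indicator (A j) (f j) :: real) \<le> 1" for f
      by (auto intro!: prod_nonneg prod_le_1 simp: indicator_def)
    have sumk: "(\<Sum>i\<in>I-J. g i) = (\<Sum>i\<in>I - insert k J. g i) + g k" for g :: "_ \<Rightarrow> real"
    proof -
      have "I - J = insert k (I - insert k J)" using k insert.hyps by auto
      then have "(\<Sum>i\<in>I-J. g i) = sum g (insert k (I - insert k J))" by (rule arg_cong)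
      also have "\<dots> = (\<Sum>i\<in>I - insert k J. g i) + g k" using I by simp
      finally show ?thesis .
    qed
    have lin: "(\<Sum>i\<in>I - insert k J. ((\<lambda>i. a * c i)(k := t)) i * f i) = a * (\<Sum>i\<in>I - insert k J. c i * f i)" for a t f
      unfolding sum_distrib_left by (intro sum.cong) auto
    have "(\<integral>\<omega>. ((\<Prod>j\<in>J. indicator (A j) (X j \<omega>)) * indicator (A k) (X k \<omega>)) *\<^sub>R iexp (\<Sum>i\<in>I - insert k J. c i * X i \<omega>) \<partial>M) =
      (\<integral>\<omega>. ((\<Prod>j\<in>J. indicator (A j) (Y j \<omega>)) * indicator (A k) (Y k \<omega>)) *\<^sub>R iexp (\<Sum>i\<in>I - insert k J. c i * Y i \<omega>) \<partial>N)"
    proof (rule indicator_iexp_uniqueness[OF M N])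
      show "(\<integral>\<omega>. (\<Prod>j\<in>J. indicator (A j) (X j \<omega>)) *\<^sub>R iexp (a * (\<Sum>i\<in>I - insert k J. c i * X i \<omega>) + t * X k \<omega>) \<partial>M) =
          (\<integral>\<omega>. (\<Prod>j\<in>J. indicator (A j) (Y j \<omega>)) *\<^sub>R iexp (a * (\<Sum>i\<in>I - insert k J. c i * Y i \<omega>) + t * Y k \<omega>) \<partial>N)" for a t
        using insert.IH[OF J, of "(\<lambda>i. a * c i)(k := t)"] unfolding sumk lin by simp
    qed (use bnd k J A in \<open>auto intro!: borel_measurable_prod borel_measurable_sum borel_measurable_times
        measurable_compose[OF X] measurable_compose[OF Y] borel_measurable_indicator intro: A subsetD[OF J]\<close>)
    then show ?case
      using insert.hyps by (simp add: mult.commute)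
  qed
  let ?P = "Pi\<^sub>M I (\<lambda>_. borel :: real measure)"
  have mX: "(\<lambda>\<omega>. \<lambda>i\<in>I. X i \<omega>) \<in> measurable M ?P" using X by (intro measurable_restrict)
  have mY: "(\<lambda>\<omega>. \<lambda>i\<in>I. Y i \<omega>) \<in> measurable N ?P" using Y by (intro measurable_restrict)
  interpret PX: prob_space "distr M ?P (\<lambda>\<omega>. \<lambda>i\<in>I. X i \<omega>)" by (rule M.prob_space_distr[OF mX])
  interpret PY: prob_space "distr N ?P (\<lambda>\<omega>. \<lambda>i\<in>I. Y i \<omega>)" by (rule N.prob_space_distr[OF mY])
  have rect: "complex_of_real (measure (distr L ?P (\<lambda>\<omega>. \<lambda>i\<in>I. Z i \<omega>)) (Pi\<^sub>E I A)) =
      (\<integral>\<omega>. (\<Prod>j\<in>I. indicator (A j) (Z j \<omega>)) *\<^sub>R iexp (\<Sum>i\<in>I-I. 0 * Z i \<omega>) \<partial>L)"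
    if mZ: "(\<lambda>\<omega>. \<lambda>i\<in>I. Z i \<omega>) \<in> measurable L ?P" and A: "\<And>i. i \<in> I \<Longrightarrow> A i \<in> sets borel"
    for L :: "'z measure" and Z A
  proof -
    have S: "Pi\<^sub>E I A \<in> sets ?P" using A I by (intro sets_PiM_I_finite) auto
    have "Pi\<^sub>E I A \<inter> (I \<rightarrow>\<^sub>E UNIV) = Pi\<^sub>E I A" by (auto simp: PiE_iff)
    then have "measure (distr L ?P (\<lambda>\<omega>. \<lambda>i\<in>I. Z i \<omega>)) (Pi\<^sub>E I A) =
        (\<integral>x. indicator (Pi\<^sub>E I A) x \<partial>distr L ?P (\<lambda>\<omega>. \<lambda>i\<in>I. Z i \<omega>))"
      by (simp add: space_PiM)
    also have "\<dots> = (\<integral>\<omega>. indicator (Pi\<^sub>E I A) (\<lambda>i\<in>I. Z i \<omega>) \<partial>L)"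
      by (rule integral_distr[OF mZ]) (use S in auto)
    also have "\<dots> = (\<integral>\<omega>. (\<Prod>j\<in>I. indicator (A j) (Z j \<omega>)) \<partial>L)"
      by (intro Bochner_Integration.integral_cong)
        (auto simp: indicator_def prod_eq_1_iff PiE_iff I intro!: prod.neutral)
    finally show ?thesis by (simp add: scaleR_conv_of_real flip: integral_complex_of_real)
  qed
  show ?thesis
  proof (rule measure_eqI_PiM_finite[OF I])
    fix A :: "'i \<Rightarrow> real set" assume A: "\<And>i. i \<in> I \<Longrightarrow> A i \<in> sets borel"
    have "complex_of_real (measure (distr M ?P (\<lambda>\<omega>. \<lambda>i\<in>I. X i \<omega>)) (Pi\<^sub>E I A)) =
        complex_of_real (measure (distr N ?P (\<lambda>\<omega>. \<lambda>i\<in>I. Y i \<omega>)) (Pi\<^sub>E I A))"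
      using rect[OF mX A] rect[OF mY A] mixed[of I A "\<lambda>_. 0", OF subset_refl A] by simp
    then show "emeasure (distr M ?P (\<lambda>\<omega>. \<lambda>i\<in>I. X i \<omega>)) (Pi\<^sub>E I A) =
        emeasure (distr N ?P (\<lambda>\<omega>. \<lambda>i\<in>I. Y i \<omega>)) (Pi\<^sub>E I A)"
      by (simp add: PX.emeasure_eq_measure PY.emeasure_eq_measure)
  next
    show "range (\<lambda>n::nat. Pi\<^sub>E I (\<lambda>_. UNIV)) \<subseteq> prod_algebra I (\<lambda>_. borel)"
      using I by (auto intro!: prod_algebraI_finite)
  qed (auto simp: space_PiM PX.emeasure_eq_measure)
qed

section \<open>Gaussian variables and rotation of the field\<close>

lemma centered_gaussian_cases:
  assumes "centered_gaussian M X"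
  obtains (degenerate) "AE \<omega> in M. X \<omega> = 0"
  | (normal) \<sigma> where "0 < \<sigma>" "distributed M lborel X (\<lambda>x. ennreal (normal_density 0 \<sigma> x))"
  using assms by (auto simp: centered_gaussian_def)

lemma normal_second_moment:
  assumes "prob_space M" "0 < \<sigma>" and D: "distributed M lborel X (\<lambda>x. ennreal (normal_density 0 \<sigma> x))"
  shows "(\<integral>\<omega>. (X \<omega>)\<^sup>2 \<partial>M) = \<sigma>\<^sup>2"
proof -
  interpret prob_space M by fact
  show ?thesis
    using normal_distributed_variance[OF assms(2) D] normal_distributed_expectation[OF assms(2) D] by simp
qed

text \<open>
  Tilting the normal density by \<open>exp (s * x)\<close> only moves its mean.
\<close>

lemma centered_gaussian_exp_moment:
  assumes M: "prob_space M" and X: "centered_gaussian M X"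
  shows "(\<integral>\<^sup>+\<omega>. ennreal (exp (s * X \<omega>)) \<partial>M) = ennreal (exp (s\<^sup>2 * (\<integral>\<omega>. (X \<omega>)\<^sup>2 \<partial>M) / 2))"
proof -
  interpret prob_space M by fact
  have [measurable]: "X \<in> borel_measurable M" using X by (simp add: centered_gaussian_def)
  show ?thesis
    using X
  proof (cases rule: centered_gaussian_cases)
    case degenerate
    then have "(\<integral>\<^sup>+\<omega>. ennreal (exp (s * X \<omega>)) \<partial>M) = (\<integral>\<^sup>+\<omega>. 1 \<partial>M)"
      by (intro nn_integral_cong_AE) auto
    moreover have "(\<integral>\<omega>. (X \<omega>)\<^sup>2 \<partial>M) = 0"
      using degenerate by (intro integral_eq_zero_AE) auto
    ultimately show ?thesis by (simp add: emeasure_space_1)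
  next
    case (normal \<sigma>)
    have tilt: "normal_density 0 \<sigma> x * exp (s * x) = exp (s\<^sup>2 * \<sigma>\<^sup>2 / 2) * normal_density (s * \<sigma>\<^sup>2) \<sigma> x" for x
    proof -
      have "- x\<^sup>2 / (2 * \<sigma>\<^sup>2) + s * x = s\<^sup>2 * \<sigma>\<^sup>2 / 2 + - (x - s * \<sigma>\<^sup>2)\<^sup>2 / (2 * \<sigma>\<^sup>2)"
        using normal by (simp add: field_simps power2_eq_square)
      then show ?thesis
        by (simp add: normal_density_def exp_add[symmetric] mult.assoc[symmetric] mult.commute)
    qed
    have "(\<integral>\<^sup>+\<omega>. ennreal (exp (s * X \<omega>)) \<partial>M) = (\<integral>\<^sup>+x. ennreal (normal_density 0 \<sigma> x) * ennreal (exp (s * x)) \<partial>lborel)"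
      by (rule distributed_nn_integral[OF normal(2), symmetric]) simp
    also have "\<dots> = (\<integral>\<^sup>+x. ennreal (exp (s\<^sup>2 * \<sigma>\<^sup>2 / 2)) * ennreal (normal_density (s * \<sigma>\<^sup>2) \<sigma> x) \<partial>lborel)"
      by (simp add: ennreal_mult'[symmetric] tilt)
    also have "\<dots> = ennreal (exp (s\<^sup>2 * \<sigma>\<^sup>2 / 2)) * (\<integral>\<^sup>+x. ennreal (normal_density (s * \<sigma>\<^sup>2) \<sigma> x) \<partial>lborel)"
      by (rule nn_integral_cmult) simp
    also have "(\<integral>\<^sup>+x. ennreal (normal_density (s * \<sigma>\<^sup>2) \<sigma> x) \<partial>lborel) = 1"
      using normal by (subst nn_integral_eq_integral) auto
    finally show ?thesis using normal_second_moment[OF M normal] by simp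
  qed
qed

lemma centered_gaussian_char:
  assumes M: "prob_space M" and X: "centered_gaussian M X"
  shows "(\<integral>\<omega>. iexp (X \<omega>) \<partial>M) = exp (- of_real (\<integral>\<omega>. (X \<omega>)\<^sup>2 \<partial>M) / 2)"
proof -
  interpret prob_space M by fact
  have [measurable]: "X \<in> borel_measurable M" using X by (simp add: centered_gaussian_def)
  show ?thesis
    using X
  proof (cases rule: centered_gaussian_cases)
    case degenerate
    then have "(\<integral>\<omega>. iexp (X \<omega>) \<partial>M) = (\<integral>\<omega>. 1 \<partial>M)"
      by (intro integral_cong_AE) auto
    moreover have "(\<integral>\<omega>. (X \<omega>)\<^sup>2 \<partial>M) = 0"
      using degenerate by (intro integral_eq_zero_AE) auto
    ultimately show ?thesis by (simp add: prob_space)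
  next
    case (normal \<sigma>)
    have "distributed M lborel (\<lambda>\<omega>. (X \<omega> - 0) / \<sigma>) std_normal_density"
      using normal_standard_normal_convert[OF normal(1), of X 0] normal(2) by simp
    then have D: "distr M lborel (\<lambda>\<omega>. X \<omega> / \<sigma>) = std_normal_distribution"
      by (simp add: distributed_def)
    have "(\<integral>\<omega>. iexp (X \<omega>) \<partial>M) = (\<integral>\<omega>. iexp (\<sigma> * (X \<omega> / \<sigma>)) \<partial>M)"
      using normal by simp
    also have "\<dots> = (\<integral>x. iexp (\<sigma> * x) \<partial>distr M lborel (\<lambda>\<omega>. X \<omega> / \<sigma>))"
      by (rule integral_distr[symmetric]) auto
    also have "\<dots> = char std_normal_distribution \<sigma>"
      by (simp add: D char_def)
    also have "\<dots> = exp (- of_real (\<sigma>\<^sup>2) / 2)"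
      by (simp add: char_std_normal_distribution exp_of_real[symmetric])
    finally show ?thesis using normal_second_moment[OF M normal] by simp
  qed
qed

text \<open>
  The Chernoff bound with the optimal tilt \<open>t / v\<close>, applied to \<open>X\<close> and \<open>- X\<close>. It asks only for an upper
  bound \<open>v\<close> of the variance and so covers degenerate variables.
\<close>

lemma centered_gaussian_tail:
  assumes M: "prob_space M" and X: "centered_gaussian M X"
    and v: "(\<integral>\<omega>. (X \<omega>)\<^sup>2 \<partial>M) \<le> v" "0 < v" and t: "0 \<le> t"
  shows "measure M {\<omega>\<in>space M. t \<le> \<bar>X \<omega>\<bar>} \<le> 2 * exp (- t\<^sup>2 / (2 * v))"
proof -
  interpret prob_space M by fact
  have [measurable]: "X \<in> borel_measurable M" using X by (simp add: centered_gaussian_def)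
  have one_sided: "measure M {\<omega>\<in>space M. t \<le> e * X \<omega>} \<le> exp (- t\<^sup>2 / (2 * v))" if e: "e\<^sup>2 = 1" for e :: real
  proof -
    have "emeasure M {\<omega>\<in>space M. t \<le> e * X \<omega>} \<le> emeasure M {\<omega>\<in>space M. 1 \<le> ennreal (exp (- t\<^sup>2 / v)) * ennreal (exp (t / v * e * X \<omega>))}"
    proof (rule emeasure_mono)
      show "{\<omega>\<in>space M. t \<le> e * X \<omega>} \<subseteq> {\<omega>\<in>space M. 1 \<le> ennreal (exp (- t\<^sup>2 / v)) * ennreal (exp (t / v * e * X \<omega>))}"
      proof safe
        fix \<omega> assume "t \<le> e * X \<omega>"
        then have "t / v * t \<le> t / v * (e * X \<omega>)" using t v by (intro mult_left_mono) auto
        then have "exp 0 \<le> exp (- t\<^sup>2 / v + t / v * e * X \<omega>)"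
          by (subst exp_le_cancel_iff) (simp add: power2_eq_square)
        then have "1 \<le> exp (- t\<^sup>2 / v) * exp (t / v * e * X \<omega>)" by (simp only: exp_add exp_zero)
        then show "1 \<le> ennreal (exp (- t\<^sup>2 / v)) * ennreal (exp (t / v * e * X \<omega>))"
          by (simp add: ennreal_mult'[symmetric])
      qed
    qed simp
    also have "\<dots> \<le> ennreal (exp (- t\<^sup>2 / v)) * (\<integral>\<^sup>+\<omega>. ennreal (exp (t / v * e * X \<omega>)) * indicator (space M) \<omega> \<partial>M)"
      using nn_integral_Markov_inequality[of "\<lambda>\<omega>. ennreal (exp (t / v * e * X \<omega>))" "space M" M "ennreal (exp (- t\<^sup>2 / v))"]
      by simp
    also have "(\<integral>\<^sup>+\<omega>. ennreal (exp (t / v * e * X \<omega>)) * indicator (space M) \<omega> \<partial>M) = (\<integral>\<^sup>+\<omega>. ennreal (exp (t / v * e * X \<omega>)) \<partial>M)"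
      by (intro nn_integral_cong) auto
    also have "\<dots> = ennreal (exp ((t / v * e)\<^sup>2 * (\<integral>\<omega>. (X \<omega>)\<^sup>2 \<partial>M) / 2))"
      by (rule centered_gaussian_exp_moment[OF M X])
    also have "\<dots> \<le> ennreal (exp ((t / v * e)\<^sup>2 * v / 2))"
      using v by (intro ennreal_leI) (auto intro!: mult_left_mono)
    also have "ennreal (exp (- t\<^sup>2 / v)) * \<dots> = ennreal (exp (- t\<^sup>2 / (2 * v)))"
    proof -
      have "- t\<^sup>2 / v + (t / v * e)\<^sup>2 * v / 2 = - t\<^sup>2 / (2 * v)"
        using v e by (simp add: power_mult_distrib field_simps power2_eq_square)
      then show ?thesis by (simp add: ennreal_mult'[symmetric] exp_add[symmetric])
    qed
    finally show ?thesis
      by (simp add: emeasure_eq_measure mult_left_mono)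
  qed
  have "{\<omega>\<in>space M. t \<le> \<bar>X \<omega>\<bar>} = {\<omega>\<in>space M. t \<le> 1 * X \<omega>} \<union> {\<omega>\<in>space M. t \<le> (-1) * X \<omega>}"
    by auto
  then have "measure M {\<omega>\<in>space M. t \<le> \<bar>X \<omega>\<bar>} \<le> measure M {\<omega>\<in>space M. t \<le> 1 * X \<omega>} + measure M {\<omega>\<in>space M. t \<le> (-1) * X \<omega>}"
    by (simp add: measure_Un_le)
  then show ?thesis using one_sided[of 1] one_sided[of "-1"] by simp
qed

context
  fixes M :: "'w measure" and h :: "'a::euclidean_space signed_pair \<Rightarrow> 'w \<Rightarrow> real"
  assumes field: "log_correlated_field M h"
begin

lemma field_prob_space: "prob_space M"
  using field by (simp add: log_correlated_field_def)

lemma field_linear_combination_gaussian: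
  "finite F \<Longrightarrow> F \<subseteq> mass_zero_finite_energy \<Longrightarrow> centered_gaussian M (\<lambda>\<omega>. \<Sum>\<rho>\<in>F. c \<rho> * h \<rho> \<omega>)"
  using field by (simp add: log_correlated_field_def)

lemma field_gaussian:
  assumes "\<rho> \<in> mass_zero_finite_energy"
  shows "centered_gaussian M (h \<rho>)"
  using field_linear_combination_gaussian[of "{\<rho>}" "\<lambda>_. 1"] assms by simp

lemma field_measurable:
  "\<rho> \<in> mass_zero_finite_energy \<Longrightarrow> h \<rho> \<in> borel_measurable M"
  using field_gaussian by (simp add: centered_gaussian_def)

lemma field_second_moment:
  assumes "\<rho> \<in> mass_zero_finite_energy"
  shows "(\<integral>\<omega>. (h \<rho> \<omega>)\<^sup>2 \<partial>M) = log_covariance \<rho> \<rho>"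
  using field assms by (simp add: log_correlated_field_def power2_eq_square)

text \<open>
  Every linear combination of the values of the field is a centered Gaussian. Its characteristic function
  depends only on its variance \<open>v\<close>, and \<open>a\<^sup>2 * v + b\<^sup>2 * v = v\<close>.
\<close>

lemma field_rotation_invariance:
  fixes a b :: real
  assumes F: "finite F" "F \<subseteq> mass_zero_finite_energy" and ab: "a\<^sup>2 + b\<^sup>2 = 1"
  shows "distr M (Pi\<^sub>M F (\<lambda>_. borel)) (\<lambda>\<omega>. \<lambda>\<rho>\<in>F. h \<rho> \<omega>) =
    distr (M \<Otimes>\<^sub>M M) (Pi\<^sub>M F (\<lambda>_. borel)) (\<lambda>\<omega>. \<lambda>\<rho>\<in>F. a * h \<rho> (fst \<omega>) + b * h \<rho> (snd \<omega>))"
proof (rule cramer_wold)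
  interpret prob_space M by (rule field_prob_space)
  interpret P: pair_prob_space M M ..
  show "prob_space M" "prob_space (M \<Otimes>\<^sub>M M)" by unfold_locales
  have meas [measurable]: "\<rho> \<in> F \<Longrightarrow> h \<rho> \<in> borel_measurable M" for \<rho>
    by (rule field_measurable) (use F in blast)
  show "h \<rho> \<in> borel_measurable M" if "\<rho> \<in> F" for \<rho> using meas[OF that] .
  show "(\<lambda>\<omega>. a * h \<rho> (fst \<omega>) + b * h \<rho> (snd \<omega>)) \<in> borel_measurable (M \<Otimes>\<^sub>M M)" if "\<rho> \<in> F" for \<rho>
    using meas[OF that] by simp
  fix c :: "'a signed_pair \<Rightarrow> real"
  define X where "X = (\<lambda>\<omega>. \<Sum>\<rho>\<in>F. c \<rho> * h \<rho> \<omega>)"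
  have X [measurable]: "X \<in> borel_measurable M" unfolding X_def by measurable
  define v where "v = (\<integral>\<omega>. (X \<omega>)\<^sup>2 \<partial>M)"
  have char: "(\<integral>\<omega>. iexp (e * X \<omega>) \<partial>M) = exp (- of_real (e\<^sup>2 * v) / 2)" for e :: real
  proof -
    have eX: "e * X \<omega> = (\<Sum>\<rho>\<in>F. (e * c \<rho>) * h \<rho> \<omega>)" for \<omega>
      by (simp add: X_def sum_distrib_left mult.assoc)
    have g: "centered_gaussian M (\<lambda>\<omega>. e * X \<omega>)"
      unfolding eX by (rule field_linear_combination_gaussian[OF F])
    show ?thesis
      using centered_gaussian_char[OF field_prob_space g] by (simp add: power_mult_distrib v_def)
  qed
  have "(\<integral>\<omega>. iexp (\<Sum>\<rho>\<in>F. c \<rho> * (a * h \<rho> (fst \<omega>) + b * h \<rho> (snd \<omega>))) \<partial>(M \<Otimes>\<^sub>M M)) =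
      (\<integral>\<omega>. iexp (a * X (fst \<omega>)) * iexp (b * X (snd \<omega>)) \<partial>(M \<Otimes>\<^sub>M M))"
  proof -
    have "(\<Sum>\<rho>\<in>F. c \<rho> * (a * h \<rho> x + b * h \<rho> y)) = a * X x + b * X y" for x y
      by (simp add: X_def sum_distrib_left sum.distrib[symmetric] algebra_simps)
    then show ?thesis by (simp add: exp_add distrib_left)
  qed
  also have "\<dots> = (\<integral>x. (\<integral>y. iexp (a * X x) * iexp (b * X y) \<partial>M) \<partial>M)"
  proof -
    have "integrable (M \<Otimes>\<^sub>M M) (\<lambda>\<omega>. iexp (a * X (fst \<omega>)) * iexp (b * X (snd \<omega>)))"
      by (rule P.integrable_const_bound[of _ 1]) (auto simp: norm_exp_i_times norm_mult)
    from P.integral_fst'[OF this] show ?thesis by simp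
  qed
  also have "\<dots> = exp (- of_real (a\<^sup>2 * v) / 2) * exp (- of_real (b\<^sup>2 * v) / 2)"
    by (simp only: integral_mult_right_zero integral_mult_left_zero char)
  also have "\<dots> = exp (- of_real (1\<^sup>2 * v) / 2)"
  proof -
    have "- (complex_of_real (a\<^sup>2 * v)) / 2 + - complex_of_real (b\<^sup>2 * v) / 2 = - of_real ((a\<^sup>2 + b\<^sup>2) * v) / 2"
      by (simp add: field_simps)
    then show ?thesis by (simp only: exp_add[symmetric] ab) simp
  qed
  also have "\<dots> = (\<integral>\<omega>. iexp (\<Sum>\<rho>\<in>F. c \<rho> * h \<rho> \<omega>) \<partial>M)"
    using char[of 1] by (simp add: X_def)
  finally show "(\<integral>\<omega>. iexp (\<Sum>\<rho>\<in>F. c \<rho> * h \<rho> \<omega>) \<partial>M) =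
      (\<integral>\<omega>. iexp (\<Sum>\<rho>\<in>F. c \<rho> * (a * h \<rho> (fst \<omega>) + b * h \<rho> (snd \<omega>))) \<partial>(M \<Otimes>\<^sub>M M))"
    by simp
qed (use F in auto)

end

section \<open>Logarithmic energies\<close>

lemma dyadic_count_ge:
  fixes t :: real
  assumes "\<And>k. k < n \<Longrightarrow> t < (1/2)^k"
  shows "of_nat n \<le> (\<Sum>k. indicator {..<(1/2)^k} t :: ennreal)"
proof -
  have "of_nat n = (\<Sum>k<n. indicator {..<(1/2)^k} t :: ennreal)"
    using assms by (simp add: indicator_def)
  also have "\<dots> \<le> (\<Sum>k. indicator {..<(1/2)^k} t :: ennreal)"
    by (intro sum_le_suminf) auto
  finally show ?thesis .
qed

text \<open>
  The logarithm is controlled by counting the dyadic scales above \<open>t\<close>; after integration the count becomes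
  a sum of masses of balls. At \<open>t = 0\<close> both sides are infinite.
\<close>

lemma neg_ln_le_dyadic_count:
  fixes t :: real
  assumes "0 \<le> t"
  shows "(if t = 0 then \<infinity> else ennreal (- ln t)) \<le> (\<Sum>k. indicator {..<(1/2)^k} t)"
proof (cases "t = 0")
  case True
  have "of_nat n \<le> (\<Sum>k. indicator {..<(1/2)^k} t :: ennreal)" for n
    by (rule dyadic_count_ge) (simp add: True)
  then have "(\<Sum>k. indicator {..<(1/2)^k} t :: ennreal) = \<infinity>"
    using ennreal_Ex_less_of_nat[of "\<Sum>k. indicator {..<(1/2)^k} t"]
    by (auto simp: not_less[symmetric] less_top[symmetric])
  then show ?thesis by simp
next
  case False
  then have t: "0 < t" using assms by simp
  obtain m where "(1/2)^m < t" using real_arch_pow_inv[OF t, of "1/2"] by auto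
  then have ex: "(1/2)^m \<le> t" by simp
  define n where "n = (LEAST n. (1/2)^n \<le> t)"
  have n: "(1/2)^n \<le> t" unfolding n_def by (rule LeastI[of _ m]) (rule ex)
  have "t < (1/2)^k" if "k < n" for k
    using not_less_Least[of k "\<lambda>n. (1/2)^n \<le> t"] that by (simp add: n_def)
  then have count: "of_nat n \<le> (\<Sum>k. indicator {..<(1/2)^k} t :: ennreal)"
    by (rule dyadic_count_ge)
  have "- ln t \<le> - ln ((1/2)^n)" using n t by (subst neg_le_iff_le) (intro ln_mono, auto)
  also have "\<dots> = n * ln 2" by (simp add: ln_realpow ln_div)
  also have "\<dots> \<le> real n" using ln_2_less_1 mult_left_mono[of "ln 2" 1 "real n"] by simp
  finally have "ennreal (- ln t) \<le> of_nat n" by (simp add: ennreal_of_nat_eq_real_of_nat ennreal_leI)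
  from order_trans[OF this count] show ?thesis using False by (simp only: if_False)
qed

lemma log_potential_le_dyadic_mass:
  fixes x :: "'a::euclidean_space"
  assumes [measurable_cong]: "sets \<beta> = sets borel" and c: "0 < c"
  shows "(\<integral>\<^sup>+y. (if x = y then \<infinity> else ennreal (ln (c / dist x y))) \<partial>\<beta>) \<le> (\<Sum>k. emeasure \<beta> (ball x (c * (1/2)^k)))"
proof -
  have "(\<integral>\<^sup>+y. (if x = y then \<infinity> else ennreal (ln (c / dist x y))) \<partial>\<beta>) \<le>
      (\<integral>\<^sup>+y. (\<Sum>k. indicator (ball x (c * (1/2)^k)) y) \<partial>\<beta>)"
  proof (rule nn_integral_mono)
    fix y
    have "(if dist x y / c = 0 then \<infinity> else ennreal (- ln (dist x y / c))) \<le> (\<Sum>k. indicator {..<(1/2)^k} (dist x y / c))"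
      using c by (intro neg_ln_le_dyadic_count) auto
    also have "\<dots> = (\<Sum>k. indicator (ball x (c * (1/2)^k)) y)"
      using c by (intro suminf_cong) (auto simp: indicator_def field_simps)
    finally show "(if x = y then \<infinity> else ennreal (ln (c / dist x y))) \<le> (\<Sum>k. indicator (ball x (c * (1/2)^k)) y)"
      using c by (auto simp: ln_div split: if_splits)
  qed
  also have "\<dots> = (\<Sum>k. \<integral>\<^sup>+y. indicator (ball x (c * (1/2)^k)) y \<partial>\<beta>)"
    by (rule nn_integral_suminf) (auto intro!: borel_measurable_indicator simp: assms(1))
  finally show ?thesis by (simp add: assms(1))
qed

text \<open>
  A bound for the potential of \<open>\<beta>\<close> with kernel \<open>ln (c / \<bar>x - y\<bar>)\<close>, cut off at zero, that is uniform in \<open>x\<close>. For the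
  uniform measure on a box of size \<open>c\<close> one can take \<open>B = 2\<close> whatever \<open>c\<close> is, and its energy is then at most
  \<open>ln (1 / c) + 2\<close>.
\<close>

definition dyadic_mass_bound :: "'a::euclidean_space measure \<Rightarrow> real \<Rightarrow> real \<Rightarrow> bool" where
  "dyadic_mass_bound \<beta> c B \<longleftrightarrow> 0 \<le> B \<and> (\<forall>x. (\<Sum>k. emeasure \<beta> (ball x (c * (1/2)^k))) \<le> ennreal B)"

definition supported_probability :: "'a::euclidean_space measure \<Rightarrow> real \<Rightarrow> bool" where
  "supported_probability \<mu> R \<longleftrightarrow> prob_space \<mu> \<and> sets \<mu> = sets borel \<and> (AE x in \<mu>. norm x \<le> R)"

lemma supported_probability_AE_dist:
  assumes "supported_probability \<alpha> R" "supported_probability \<beta> S"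
  shows "AE p in \<alpha> \<Otimes>\<^sub>M \<beta>. dist (fst p) (snd p) \<le> R + S"
proof -
  interpret a: prob_space \<alpha> using assms by (simp add: supported_probability_def)
  interpret b: prob_space \<beta> using assms by (simp add: supported_probability_def)
  interpret pair_prob_space \<alpha> \<beta> ..
  have [measurable_cong]: "sets \<alpha> = sets borel" "sets \<beta> = sets borel"
    using assms by (auto simp: supported_probability_def)
  have "AE x in \<alpha>. AE y in \<beta>. dist x y \<le> R + S"
  proof -
    have AE_a: "AE x in \<alpha>. norm x \<le> R" and AE_b: "AE y in \<beta>. norm y \<le> S"
      using assms by (auto simp: supported_probability_def)
    from AE_a show ?thesis
    proof eventually_elim
      case (elim x)
      from AE_b show ?case
      proof eventually_elim
        case (elim y)
        then show ?case using \<open>norm x \<le> R\<close> norm_triangle_ineq4[of x y] by (simp add: dist_norm)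
      qed
    qed
  qed
  then show ?thesis by (intro AE_pair_measure) simp_all
qed

lemma nn_log_energy_le_dyadic_mass:
  assumes a: "supported_probability \<alpha> R" and b: "supported_probability \<beta> S"
    and B: "dyadic_mass_bound \<beta> c B" and c: "0 < c"
  shows "(\<integral>\<^sup>+p. (if fst p = snd p then \<infinity> else ennreal (ln (c / dist (fst p) (snd p)))) \<partial>(\<alpha> \<Otimes>\<^sub>M \<beta>)) \<le> ennreal B"
proof -
  interpret a: prob_space \<alpha> using a by (simp add: supported_probability_def)
  interpret b: prob_space \<beta> using b by (simp add: supported_probability_def)
  have sets [measurable_cong]: "sets \<alpha> = sets borel" "sets \<beta> = sets borel"
    using a b by (auto simp: supported_probability_def)
  have "(\<lambda>p. if dist (fst p) (snd p) = 0 then \<infinity> else ennreal (ln (c / dist (fst p) (snd p)))) \<in> borel_measurable (\<alpha> \<Otimes>\<^sub>M \<beta>)"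
    by measurable
  then have "(\<lambda>p. if fst p = snd p then \<infinity> else ennreal (ln (c / dist (fst p) (snd p)))) \<in> borel_measurable (\<alpha> \<Otimes>\<^sub>M \<beta>)"
    by simp
  from b.nn_integral_fst[OF this, unfolded fst_conv snd_conv]
  have "(\<integral>\<^sup>+p. (if fst p = snd p then \<infinity> else ennreal (ln (c / dist (fst p) (snd p)))) \<partial>(\<alpha> \<Otimes>\<^sub>M \<beta>)) =
      (\<integral>\<^sup>+x. \<integral>\<^sup>+y. (if x = y then \<infinity> else ennreal (ln (c / dist x y))) \<partial>\<beta> \<partial>\<alpha>)"
    by simp
  also have "\<dots> \<le> (\<integral>\<^sup>+x. ennreal B \<partial>\<alpha>)"
    using B by (intro nn_integral_mono order_trans[OF log_potential_le_dyadic_mass[OF sets(2) c]])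
      (simp add: dyadic_mass_bound_def)
  also have "\<dots> = ennreal B" by (simp add: a.emeasure_space_1)
  finally show ?thesis .
qed

text \<open>
  Near the diagonal the kernel is controlled by the potential of \<open>\<beta>\<close>; away from it by the distance, which is
  bounded since both measures have bounded support.
\<close>

lemma abs_log_energy_finite:
  assumes a: "supported_probability \<alpha> R" and b: "supported_probability \<beta> S"
    and B: "dyadic_mass_bound \<beta> 1 B"
  shows "abs_log_energy \<alpha> \<beta> < \<infinity>"
proof -
  interpret a: prob_space \<alpha> using a by (simp add: supported_probability_def)
  interpret b: prob_space \<beta> using b by (simp add: supported_probability_def)
  interpret pair_prob_space \<alpha> \<beta> ..
  have sets [measurable_cong]: "sets \<alpha> = sets borel" "sets \<beta> = sets borel"
    using a b by (auto simp: supported_probability_def)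
  let ?g = "\<lambda>p::'a\<times>'a. if dist (fst p) (snd p) = 0 then \<infinity> else ennreal (ln (1 / dist (fst p) (snd p)))"
  have g [measurable]: "?g \<in> borel_measurable (\<alpha> \<Otimes>\<^sub>M \<beta>)"
    by measurable
  have "abs_log_energy \<alpha> \<beta> \<le> (\<integral>\<^sup>+p. ?g p + ennreal (R + S) \<partial>(\<alpha> \<Otimes>\<^sub>M \<beta>))"
    unfolding abs_log_energy_def
  proof (rule nn_integral_mono_AE)
    show "AE p in \<alpha> \<Otimes>\<^sub>M \<beta>. (if fst p = snd p then \<infinity> else ennreal \<bar>ln (dist (fst p) (snd p))\<bar>) \<le> ?g p + ennreal (R + S)"
      using supported_probability_AE_dist[OF a b]
    proof eventually_elim
      case (elim p)
      show ?case
      proof (cases "fst p = snd p")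
        case False
        then have pos: "0 < dist (fst p) (snd p)" by simp
        show ?thesis
        proof (cases "dist (fst p) (snd p) \<le> 1")
          case True
          then have "\<bar>ln (dist (fst p) (snd p))\<bar> = ln (1 / dist (fst p) (snd p))"
            using pos by (simp add: ln_div)
          then show ?thesis using False by simp
        next
          case False
          then have "\<bar>ln (dist (fst p) (snd p))\<bar> \<le> R + S"
            using ln_le_minus_one[OF pos] elim by simp
          then have "ennreal \<bar>ln (dist (fst p) (snd p))\<bar> \<le> ennreal (R + S)" by (rule ennreal_leI)
          then show ?thesis using pos by (auto intro: order_trans add_increasing)
        qed
      qed simp
    qed
  qed
  also have "\<dots> = (\<integral>\<^sup>+p. ?g p \<partial>(\<alpha> \<Otimes>\<^sub>M \<beta>)) + ennreal (R + S)"
    by (subst nn_integral_add) (simp_all add: emeasure_space_1)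
  also have "\<dots> \<le> ennreal B + ennreal (R + S)"
    using nn_log_energy_le_dyadic_mass[OF a b B] by (intro add_right_mono) simp
  also have "\<dots> < \<infinity>" by simp
  finally show ?thesis .
qed

lemma log_energy_integrable:
  assumes a: "supported_probability \<alpha> R" and b: "supported_probability \<beta> S"
    and B: "dyadic_mass_bound \<beta> 1 B"
  shows "integrable (\<alpha> \<Otimes>\<^sub>M \<beta>) (\<lambda>p. ln (1 / dist (fst p) (snd p)))"
proof (rule integrableI_bounded)
  have sets [measurable_cong]: "sets \<alpha> = sets borel" "sets \<beta> = sets borel"
    using a b by (auto simp: supported_probability_def)
  show "(\<lambda>p. ln (1 / dist (fst p) (snd p))) \<in> borel_measurable (\<alpha> \<Otimes>\<^sub>M \<beta>)" by measurable
  have "(\<integral>\<^sup>+p. ennreal (norm (ln (1 / dist (fst p) (snd p)))) \<partial>(\<alpha> \<Otimes>\<^sub>M \<beta>)) \<le> abs_log_energy \<alpha> \<beta>"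
    unfolding abs_log_energy_def by (intro nn_integral_mono) (auto simp: ln_div)
  also have "\<dots> < \<infinity>" by (rule abs_log_energy_finite[OF a b B])
  finally show "(\<integral>\<^sup>+p. ennreal (norm (ln (1 / dist (fst p) (snd p)))) \<partial>(\<alpha> \<Otimes>\<^sub>M \<beta>)) < \<infinity>" .
qed

lemma log_energy_le:
  assumes a: "supported_probability \<alpha> R" and b: "supported_probability \<beta> S"
    and B: "dyadic_mass_bound \<beta> 1 B" and B': "dyadic_mass_bound \<beta> c B'" and c: "0 < c"
  shows "log_energy \<alpha> \<beta> \<le> ln (1 / c) + B'"
proof -
  interpret a: prob_space \<alpha> using a by (simp add: supported_probability_def)
  interpret b: prob_space \<beta> using b by (simp add: supported_probability_def)
  interpret pair_prob_space \<alpha> \<beta> ..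
  let ?f = "\<lambda>p. ln (1 / dist (fst p) (snd p))"
  note int = log_energy_integrable[OF a b B]
  have "(\<integral>p. ?f p - ln (1 / c) \<partial>(\<alpha> \<Otimes>\<^sub>M \<beta>)) \<le> B'"
  proof (rule integral_real_bounded)
    have "(\<integral>\<^sup>+p. ennreal (?f p - ln (1 / c)) \<partial>(\<alpha> \<Otimes>\<^sub>M \<beta>)) \<le>
        (\<integral>\<^sup>+p. (if fst p = snd p then \<infinity> else ennreal (ln (c / dist (fst p) (snd p)))) \<partial>(\<alpha> \<Otimes>\<^sub>M \<beta>))"
      using c by (intro nn_integral_mono) (auto simp: ln_div)
    also have "\<dots> \<le> ennreal B'" by (rule nn_log_energy_le_dyadic_mass[OF a b B' c])
    finally show "(\<integral>\<^sup>+p. ennreal (?f p - ln (1 / c)) \<partial>(\<alpha> \<Otimes>\<^sub>M \<beta>)) \<le> ennreal B'" .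
  qed (use B' in \<open>simp add: dyadic_mass_bound_def\<close>)
  also have "(\<integral>p. ?f p - ln (1 / c) \<partial>(\<alpha> \<Otimes>\<^sub>M \<beta>)) = log_energy \<alpha> \<beta> - ln (1 / c)"
    using int by (simp add: log_energy_def prob_space)
  finally show ?thesis by simp
qed

lemma log_energy_ge:
  assumes a: "supported_probability \<alpha> R" and b: "supported_probability \<beta> S"
    and B: "dyadic_mass_bound \<beta> 1 B" and RS: "0 \<le> R + S"
  shows "- (R + S) \<le> log_energy \<alpha> \<beta>"
proof -
  interpret a: prob_space \<alpha> using a by (simp add: supported_probability_def)
  interpret b: prob_space \<beta> using b by (simp add: supported_probability_def)
  interpret pair_prob_space \<alpha> \<beta> ..
  have "(\<integral>p. - (R + S) \<partial>(\<alpha> \<Otimes>\<^sub>M \<beta>)) \<le> (\<integral>p. ln (1 / dist (fst p) (snd p)) \<partial>(\<alpha> \<Otimes>\<^sub>M \<beta>))"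
  proof (rule integral_mono_AE)
    show "AE p in \<alpha> \<Otimes>\<^sub>M \<beta>. - (R + S) \<le> ln (1 / dist (fst p) (snd p))"
      using supported_probability_AE_dist[OF a b]
    proof eventually_elim
      case (elim p)
      show ?case
      proof (cases "fst p = snd p")
        case False
        then have pos: "0 < dist (fst p) (snd p)" by simp
        then show ?thesis using ln_le_minus_one[OF pos] elim by (simp add: ln_div)
      qed (use RS in simp)
    qed
  qed (use log_energy_integrable[OF a b B] in simp_all)
  then show ?thesis by (simp add: log_energy_def prob_space)
qed

lemma mass_zero_finite_energyI:
  assumes a: "supported_probability \<alpha> R" "dyadic_mass_bound \<alpha> 1 A"
    and b: "supported_probability \<beta> S" "dyadic_mass_bound \<beta> 1 B"
  shows "(\<alpha>, \<beta>) \<in> mass_zero_finite_energy"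
proof -
  interpret a: prob_space \<alpha> using a by (simp add: supported_probability_def)
  interpret b: prob_space \<beta> using b by (simp add: supported_probability_def)
  have sets: "sets \<alpha> = sets borel" "sets \<beta> = sets borel"
    using a b by (auto simp: supported_probability_def)
  have "measure \<alpha> UNIV = 1" "measure \<beta> UNIV = 1"
    using a.prob_space b.prob_space sets_eq_imp_space_eq[OF sets(1)] sets_eq_imp_space_eq[OF sets(2)] by auto
  then show ?thesis
    using sets a.finite_measure_axioms b.finite_measure_axioms
      abs_log_energy_finite[OF a(1) a(1) a(2)] abs_log_energy_finite[OF a(1) b(1) b(2)]
      abs_log_energy_finite[OF b(1) a(1) a(2)] abs_log_energy_finite[OF b(1) b(1) b(2)]
    by (auto simp: mass_zero_finite_energy_def)
qed

text \<open>
  The cross terms enter with a negative sign, so for them the lower bound of the energy suffices, which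
  comes from the supports alone. Only the self-energy of \<open>\<alpha>\<close> depends on the scale \<open>c\<close>.
\<close>

lemma log_covariance_self_le:
  assumes a: "supported_probability \<alpha> R" "dyadic_mass_bound \<alpha> 1 A" "dyadic_mass_bound \<alpha> c A'" "0 < c"
    and b: "supported_probability \<beta> S" "dyadic_mass_bound \<beta> 1 B" and RS: "0 \<le> R + S"
  shows "log_covariance (\<alpha>, \<beta>) (\<alpha>, \<beta>) \<le> ln (1 / c) + (A' + 2 * (R + S) + B)"
  using log_energy_le[OF a(1) a(1) a(2) a(3,4)] log_energy_ge[OF a(1) b RS] log_energy_ge[OF b(1) a(1,2)] RS
    log_energy_le[OF b(1) b b(2)]
  by (simp add: log_covariance_def add.commute)

lemma dyadic_mass_boundI:
  assumes "\<And>x k. emeasure \<beta> (ball x (c * (1/2)^k)) \<le> ennreal (b * (1/2)^k)" "0 \<le> b"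
  shows "dyadic_mass_bound \<beta> c (2 * b)"
  unfolding dyadic_mass_bound_def
proof (intro conjI allI)
  fix x
  have "(\<Sum>k. emeasure \<beta> (ball x (c * (1/2)^k))) \<le> (\<Sum>k. ennreal (b * (1/2)^k))"
    by (intro suminf_le assms) auto
  also have "\<dots> = ennreal (\<Sum>k. b * (1/2)^k)"
    using assms(2) by (intro suminf_ennreal2) (auto intro!: summable_mult summable_geometric)
  also have "(\<Sum>k. b * (1/2)^k) = 2 * b"
    by (subst suminf_mult) (auto simp: suminf_geometric intro!: summable_geometric)
  finally show "(\<Sum>k. emeasure \<beta> (ball x (c * (1/2)^k))) \<le> ennreal (2 * b)" .
qed (use assms(2) in simp)

section \<open>Averages over boxes and over the sphere\<close>

lemma emeasure_cube:
  fixes z :: "real ^ 'n"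
  assumes "0 \<le> r"
  shows "emeasure lborel (cbox (z - vec r) (z + vec r)) = ennreal ((2 * r) ^ CARD('n))"
proof -
  have coord: "(z + vec r - (z - vec r)) \<bullet> b = 2 * r" "(z - vec r) \<bullet> b \<le> (z + vec r) \<bullet> b" if "b \<in> Basis" for b
    using that assms by (auto simp: Basis_vec_def inner_axis inner_diff_left inner_add_left)
  have "emeasure lborel (cbox (z - vec r) (z + vec r)) = ennreal (\<Prod>b\<in>(Basis :: (real^'n) set). (z + vec r - (z - vec r)) \<bullet> b)"
    by (rule emeasure_lborel_cbox) (rule coord(2))
  also have "(\<Prod>b\<in>(Basis :: (real^'n) set). (z + vec r - (z - vec r)) \<bullet> b) = (2 * r) ^ CARD('n)"
    using coord(1) by simp
  finally show ?thesis .
qed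

lemma emeasure_ball_le_cube:
  fixes z :: "real ^ 'n"
  assumes "0 \<le> r"
  shows "emeasure lborel (ball z r) \<le> ennreal ((2 * r) ^ CARD('n))"
proof -
  have "ball z r \<subseteq> cbox (z - vec r) (z + vec r)"
  proof
    fix y assume "y \<in> ball z r"
    then have "\<bar>z $ i - y $ i\<bar> \<le> r" for i
      using component_le_norm_cart[of "z - y" i] by (simp add: dist_norm)
    then show "y \<in> cbox (z - vec r) (z + vec r)"
      by (auto simp: mem_box_cart abs_le_iff algebra_simps) 
  qed
  then have "emeasure lborel (ball z r) \<le> emeasure lborel (cbox (z - vec r) (z + vec r))"
    by (intro emeasure_mono) auto
  then show ?thesis using emeasure_cube[OF assms, of z] by simp
qed

definition box_measure :: "real \<Rightarrow> real ^ 'n \<Rightarrow> (real ^ 'n) measure" where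
  "box_measure \<epsilon> x = uniform_measure lborel (cbox (x - vec \<epsilon>) (x + vec \<epsilon>))"

text \<open>
  For \<open>r \<le> \<epsilon>\<close> the mass is at most \<open>(r / \<epsilon>)\<^sup>d\<close>, and for \<open>r > \<epsilon>\<close> it is at most \<open>1\<close>; the linear bound holds
  in both ranges and is summable over dyadic radii.
\<close>

lemma box_measure_ball:
  fixes x z :: "real ^ 'n"
  assumes e: "0 < \<epsilon>" and r: "0 \<le> r"
  shows "emeasure (box_measure \<epsilon> x) (ball z r) \<le> ennreal (r / \<epsilon>)"
proof -
  let ?Q = "cbox (x - vec \<epsilon>) (x + vec \<epsilon>)"
  have Q: "emeasure lborel ?Q = ennreal ((2 * \<epsilon>) ^ CARD('n))" using e by (intro emeasure_cube) auto
  have eq: "emeasure (box_measure \<epsilon> x) (ball z r) = emeasure lborel (?Q \<inter> ball z r) / emeasure lborel ?Q"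
    by (simp add: box_measure_def)
  show ?thesis
  proof (cases "r \<le> \<epsilon>")
    case True
    have "emeasure (box_measure \<epsilon> x) (ball z r) \<le> ennreal ((2 * r) ^ CARD('n)) / ennreal ((2 * \<epsilon>) ^ CARD('n))"
      unfolding eq Q
      by (intro divide_right_mono_ennreal order_trans[OF emeasure_mono emeasure_ball_le_cube[OF r]]) auto
    also have "\<dots> = ennreal ((r / \<epsilon>) ^ CARD('n))"
      using e r by (simp add: divide_ennreal power_divide power_mult_distrib)
    also have "\<dots> \<le> ennreal (r / \<epsilon>)"
      using True e r power_decreasing[of 1 "CARD('n)" "r / \<epsilon>"]
      by (intro ennreal_leI) (simp add: Suc_leI)
    finally show ?thesis .
  next
    case False
    have "emeasure (box_measure \<epsilon> x) (ball z r) \<le> emeasure lborel ?Q / emeasure lborel ?Q"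
      unfolding eq by (intro divide_right_mono_ennreal emeasure_mono) auto
    also have "\<dots> \<le> 1" using e unfolding Q by (simp add: divide_ennreal)
    also have "\<dots> \<le> ennreal (r / \<epsilon>)" using False e by simp
    finally show ?thesis .
  qed
qed

lemma box_measure_dyadic:
  assumes "0 < \<epsilon>" "0 < c"
  shows "dyadic_mass_bound (box_measure \<epsilon> x) c (2 * (c / \<epsilon>))"
proof (rule dyadic_mass_boundI)
  show "emeasure (box_measure \<epsilon> x) (ball z (c * (1/2)^k)) \<le> ennreal (c / \<epsilon> * (1/2)^k)" for z k
    using box_measure_ball[of \<epsilon> "c * (1/2)^k" x z] assms by simp
qed (use assms in simp)

lemma box_measure_supported:
  fixes x :: "real ^ 'n"
  assumes e: "0 < \<epsilon>" "\<epsilon> \<le> 1" and x: "x \<in> cbox 0 (vec 1)"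
  shows "supported_probability (box_measure \<epsilon> x) (2 * real CARD('n))"
  unfolding supported_probability_def
proof (intro conjI)
  let ?Q = "cbox (x - vec \<epsilon>) (x + vec \<epsilon>)"
  have Q: "emeasure lborel ?Q = ennreal ((2 * \<epsilon>) ^ CARD('n))" using e by (intro emeasure_cube) auto
  then have Q': "emeasure lborel ?Q \<noteq> 0" "emeasure lborel ?Q \<noteq> \<infinity>" using e by auto
  show "prob_space (box_measure \<epsilon> x)"
    unfolding box_measure_def by (rule prob_space_uniform_measure[OF Q'])
  show "sets (box_measure \<epsilon> x) = sets borel" by (simp add: box_measure_def)
  have "norm y \<le> 2 * real CARD('n)" if "y \<in> ?Q" for y
  proof -
    have "\<bar>y $ i\<bar> \<le> 2" for i
    proof -
      have "x $ i - \<epsilon> \<le> y $ i" "y $ i \<le> x $ i + \<epsilon>" "0 \<le> x $ i" "x $ i \<le> 1"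
        using that x by (auto simp: mem_box_cart)
      then show ?thesis using e by (auto simp: abs_le_iff)
    qed
    then have "(\<Sum>i\<in>UNIV. \<bar>y $ i\<bar>) \<le> (\<Sum>i\<in>(UNIV::'n set). 2)" by (intro sum_mono) auto
    then show ?thesis using norm_le_l1_cart[of y] by simp
  qed
  then show "AE y in box_measure \<epsilon> x. norm y \<le> 2 * real CARD('n)"
    unfolding box_measure_def by (intro AE_uniform_measureI) auto
qed

lemma uniform_sphere_supported:
  "supported_probability (uniform_sphere :: 'a::euclidean_space measure) 1"
proof -
  let ?U = "uniform_measure lborel (ball 0 1 :: 'a set)"
  have V: "emeasure lborel (ball 0 1 :: 'a set) = ennreal (measure lborel (ball 0 1 :: 'a set))"
    using emeasure_lborel_ball_finite[of "0::'a" 1] by (subst emeasure_eq_ennreal_measure) auto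
  have "0 < measure lborel (ball 0 1 :: 'a set)" by (rule content_ball_pos) simp
  then interpret U: prob_space ?U
    using V by (intro prob_space_uniform_measure) auto
  have sgn: "sgn \<in> measurable ?U (borel :: 'a measure)" by simp
  have "prob_space (distr ?U borel sgn)" by (rule U.prob_space_distr[OF sgn])
  moreover have "AE x in distr ?U borel sgn. norm x \<le> 1"
    by (subst AE_distr_iff[OF sgn]) (auto simp: norm_sgn)
  ultimately show ?thesis by (simp add: supported_probability_def uniform_sphere_def)
qed

text \<open>
  The mass of \<open>ball x r\<close> is the normalized volume of the points of the unit ball whose direction lies in
  \<open>ball x r\<close>. Such a point \<open>X\<close> is within \<open>r\<close> of \<open>norm X *\<^sub>R x\<close>, so these points lie near the segment
  from \<open>0\<close> to \<open>x\<close>, which is covered by \<open>1 / r + 1\<close> balls of radius \<open>4 * r\<close>. This gives a mass of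
  order \<open>r ^ (d - 1)\<close>, and \<open>r ^ (d - 1) \<le> r\<close> in dimension at least two.
\<close>

lemma uniform_sphere_ball:
  assumes d: "2 \<le> CARD('n)"
  obtains b where "0 \<le> b" "\<And>(x :: real ^ 'n) k. emeasure uniform_sphere (ball x ((1/2)^k)) \<le> ennreal (b * (1/2)^k)"
proof -
  let ?V = "measure lborel (ball 0 1 :: (real ^ 'n) set)"
  have cone: "{X \<in> ball 0 1. sgn X \<in> ball x r} \<subseteq> (\<Union>j\<in>{..m}. ball ((real j / real m) *\<^sub>R x) (4 * r))"
    if r: "0 < r" "r \<le> 1" and m: "real m * r = 1" for x :: "real ^ 'n" and r :: real and m :: nat
  proof
    fix X assume "X \<in> {X \<in> ball 0 1. sgn X \<in> ball x r}"
    then have X: "norm X < 1" and near: "norm (x - sgn X) < r" by (auto simp: dist_norm)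
    have m0: "0 < real m" using m r by (metis mult_eq_0_iff of_nat_0_less_iff of_nat_0 neq0_conv zero_neq_one)
    have "norm x \<le> norm (x - sgn X) + norm (sgn X)" using norm_triangle_sub[of x "sgn X"] by simp
    also have "\<dots> \<le> 2" using near r by (cases "X = 0") (auto simp: norm_sgn)
    finally have x2: "norm x \<le> 2" .
    define j where "j = nat \<lfloor>real m * norm X\<rfloor>"
    have j: "real j \<le> real m * norm X" "real m * norm X < real j + 1"
      using m0 by (auto simp: j_def)
    have jm: "j \<le> m"
    proof -
      have "real j \<le> real m * 1" using j(1) X m0 by (meson less_imp_le mult_left_mono order_trans)
      then show ?thesis by simp
    qed
    have "norm X *\<^sub>R x - X = norm X *\<^sub>R (x - sgn X)"
      by (cases "X = 0") (simp_all add: sgn_div_norm scaleR_diff_right)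
    then have 1: "norm (norm X *\<^sub>R x - X) \<le> r"
      using near X r by (simp add: mult_le_one mult_mono[of "norm X" 1 "norm (x - sgn X)" r, simplified])
    have "norm ((real j / real m) *\<^sub>R x - norm X *\<^sub>R x) = \<bar>real j / real m - norm X\<bar> * norm x"
      by (simp flip: scaleR_left_diff_distrib)
    also have "\<dots> \<le> r * 2"
    proof (rule mult_mono)
      have "r = 1 / real m" using m m0 by (simp add: field_simps)
      then show "\<bar>real j / real m - norm X\<bar> \<le> r"
        using j m0 by (simp add: abs_le_iff field_simps)
    qed (use x2 r in auto)
    finally have 2: "norm ((real j / real m) *\<^sub>R x - norm X *\<^sub>R x) \<le> r * 2" .
    have "norm ((real j / real m) *\<^sub>R x - X) \<le> 3 * r"
      using norm_triangle_ineq[of "(real j / real m) *\<^sub>R x - norm X *\<^sub>R x" "norm X *\<^sub>R x - X"] 1 2 by simp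
    then have "X \<in> ball ((real j / real m) *\<^sub>R x) (4 * r)" using r by (simp add: dist_norm)
    then show "X \<in> (\<Union>j\<in>{..m}. ball ((real j / real m) *\<^sub>R x) (4 * r))" using jm by auto
  qed
  have V: "emeasure lborel (ball 0 1 :: (real ^ 'n) set) = ennreal ?V"
    using emeasure_lborel_ball_finite[of "0::real ^ 'n" 1] by (subst emeasure_eq_ennreal_measure) auto
  have Vpos: "0 < ?V" by (rule content_ball_pos) simp
  define b where "b = 2 * 8 ^ CARD('n) / ?V"
  have "emeasure uniform_sphere (ball x ((1/2)^k)) \<le> ennreal (b * (1/2)^k)" for x :: "real ^ 'n" and k
  proof -
    define r :: real where "r = (1/2)^k"
    define m :: nat where "m = 2^k"
    have r: "0 < r" "r \<le> 1" and m: "real m * r = 1"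
      by (auto simp: r_def m_def power_le_one power_mult_distrib[symmetric])
    have m1: "1 \<le> real m" by (simp add: m_def)
    let ?S = "ball 0 1 \<inter> sgn -` ball x r"
    have S: "?S \<in> sets borel"
      using measurable_sets[OF borel_measurable_sgn, of "ball x r"] by (intro sets.Int) auto
    have "emeasure lborel ?S \<le> emeasure lborel (\<Union>j\<in>{..m}. ball ((real j / real m) *\<^sub>R x) (4 * r))"
      using cone[OF r m, of x] S by (intro emeasure_mono) auto
    also have "\<dots> \<le> (\<Sum>j\<in>{..m}. emeasure lborel (ball ((real j / real m) *\<^sub>R x) (4 * r)))"
      by (intro emeasure_subadditive_finite) auto
    also have "\<dots> \<le> (\<Sum>j\<in>{..m}. ennreal ((2 * (4 * r)) ^ CARD('n)))"
      using r by (intro sum_mono emeasure_ball_le_cube) auto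
    also have "\<dots> = ennreal (real (Suc m) * (8 * r) ^ CARD('n))"
      using r by (simp add: ennreal_mult ennreal_of_nat_eq_real_of_nat)
    also have "\<dots> \<le> ennreal (2 * 8 ^ CARD('n) * r)"
    proof (rule ennreal_leI)
      have "real (Suc m) * (8 * r) ^ CARD('n) \<le> (2 * real m) * (8 ^ CARD('n) * r\<^sup>2)"
        using m1 r d power_decreasing[of 2 "CARD('n)" r]
        by (intro mult_mono) (auto simp: power_mult_distrib)
      also have "\<dots> = 2 * 8 ^ CARD('n) * r * (real m * r)" by (simp add: power2_eq_square)
      finally show "real (Suc m) * (8 * r) ^ CARD('n) \<le> 2 * 8 ^ CARD('n) * r" by (simp add: m)
    qed
    finally have *: "emeasure lborel ?S \<le> ennreal (2 * 8 ^ CARD('n) * r)" .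
    have "emeasure uniform_sphere (ball x r) = emeasure (uniform_measure lborel (ball 0 1)) (sgn -` ball x r)"
      by (simp add: uniform_sphere_def emeasure_distr)
    also have "\<dots> = emeasure lborel ?S / ennreal ?V"
      using measurable_sets[OF borel_measurable_sgn, of "ball x r"] by (simp add: V)
    also have "\<dots> \<le> ennreal (2 * 8 ^ CARD('n) * r) / ennreal ?V"
      by (rule divide_right_mono_ennreal[OF *])
    also have "\<dots> = ennreal (b * r)" using Vpos r by (simp add: divide_ennreal b_def)
    finally show ?thesis by (simp add: r_def)
  qed
  moreover have "0 \<le> b" using Vpos by (simp add: b_def)
  ultimately show ?thesis using that by blast
qed

lemma uniform_sphere_dyadic:
  assumes "2 \<le> CARD('n)"
  obtains B where "dyadic_mass_bound (uniform_sphere :: (real ^ 'n) measure) 1 B"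
proof -
  obtain b where "0 \<le> b" "\<And>(x :: real ^ 'n) k. emeasure uniform_sphere (ball x ((1/2)^k)) \<le> ennreal (b * (1/2)^k)"
    using uniform_sphere_ball[OF assms] by blast
  then have "dyadic_mass_bound (uniform_sphere :: (real ^ 'n) measure) 1 (2 * b)"
    by (intro dyadic_mass_boundI) auto
  then show ?thesis by (rule that)
qed

text \<open>
  Later estimates see the logarithmic covariance only through this bound on the variance of the mollified
  field. What matters is that \<open>C\<close> depends neither on \<open>\<epsilon>\<close> nor on \<open>x\<close>.
\<close>

lemma box_average_index:
  assumes "2 \<le> CARD('n)"
  obtains C where "0 < C"
    "\<And>\<epsilon> (x :: real ^ 'n). 0 < \<epsilon> \<Longrightarrow> \<epsilon> \<le> 1 \<Longrightarrow> x \<in> cbox 0 (vec 1) \<Longrightarrow>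
      (box_measure \<epsilon> x, uniform_sphere) \<in> mass_zero_finite_energy \<and>
      log_covariance (box_measure \<epsilon> x, uniform_sphere) (box_measure \<epsilon> x, uniform_sphere) \<le> ln (1 / \<epsilon>) + C"
proof -
  obtain B where B: "dyadic_mass_bound (uniform_sphere :: (real ^ 'n) measure) 1 B"
    using uniform_sphere_dyadic[OF assms] .
  have B0: "0 \<le> B" using B by (simp add: dyadic_mass_bound_def)
  show ?thesis
  proof (rule that[of "2 + 2 * (2 * real CARD('n) + 1) + B"])
    fix \<epsilon> :: real and x :: "real ^ 'n"
    assume e: "0 < \<epsilon>" "\<epsilon> \<le> 1" and x: "x \<in> cbox 0 (vec 1)"
    note box = box_measure_supported[OF e x]
    have unit: "dyadic_mass_bound (box_measure \<epsilon> x) 1 (2 * (1 / \<epsilon>))" and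
      scale: "dyadic_mass_bound (box_measure \<epsilon> x) \<epsilon> 2"
      using box_measure_dyadic[of \<epsilon> 1 x] box_measure_dyadic[of \<epsilon> \<epsilon> x] e by simp_all
    show "(box_measure \<epsilon> x, uniform_sphere) \<in> mass_zero_finite_energy \<and>
      log_covariance (box_measure \<epsilon> x, uniform_sphere) (box_measure \<epsilon> x, uniform_sphere)
        \<le> ln (1 / \<epsilon>) + (2 + 2 * (2 * real CARD('n) + 1) + B)"
      using mass_zero_finite_energyI[OF box unit uniform_sphere_supported B]
        log_covariance_self_le[OF box unit scale e(1) uniform_sphere_supported B] by simp
  qed (use B0 in simp)
qed

section \<open>Lattice crossings of the cube\<close>

definition crossing_paths :: "'n::finite \<Rightarrow> real \<Rightarrow> (real ^ 'n) list set" where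
  "crossing_paths k \<epsilon> = (\<Union>z\<in>left_face k \<epsilon>. \<Union>w\<in>right_face k \<epsilon>. lattice_paths \<epsilon> (lattice_cube \<epsilon>) z w)"

lemma lfpp_set_dist_crossing:
  "lfpp_set_dist \<epsilon> \<xi> \<phi> (lattice_cube \<epsilon>) (left_face k \<epsilon>) (right_face k \<epsilon>) =
    (INF P\<in>crossing_paths k \<epsilon>. ennreal (lfpp_length \<epsilon> \<xi> \<phi> P))"
  unfolding lfpp_set_dist_def lfpp_dist_def crossing_paths_def
  by (rule antisym) (auto intro!: INF_greatest intro: INF_lower2)

lemma crossing_path_subset: "P \<in> crossing_paths k \<epsilon> \<Longrightarrow> set P \<subseteq> lattice_cube \<epsilon>"
  by (auto simp: crossing_paths_def lattice_paths_def)

lemma lattice_cube_finite_card: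
  assumes n: "0 < n"
  shows "finite (lattice_cube (1 / real n) :: (real ^ 'n) set)"
    and "card (lattice_cube (1 / real n) :: (real ^ 'n) set) \<le> (n + 1) ^ CARD('n)"
proof -
  let ?F = "(UNIV :: 'n set) \<rightarrow>\<^sub>E {..n}"
  let ?g = "\<lambda>f. (\<chi> i. real (f i) / real n) :: real ^ 'n"
  have sub: "lattice_cube (1 / real n) \<subseteq> ?g ` ?F"
  proof
    fix x :: "real ^ 'n" assume "x \<in> lattice_cube (1 / real n)"
    then obtain z where box: "x \<in> cbox 0 (vec 1)" and x: "x = (1 / real n) *\<^sub>R z" and z: "\<And>i. z $ i \<in> \<int>"
      by (auto simp: lattice_cube_def lattice_def)
    have "\<exists>m\<le>n. z $ i = real m" for i
    proof -
      obtain j where j: "z $ i = of_int j" using z[of i] by (auto elim: Ints_cases)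
      have "0 \<le> x $ i" "x $ i \<le> 1" using box by (auto simp: mem_box_cart)
      then have "0 \<le> real_of_int j" "real_of_int j \<le> real n" using n by (auto simp: x j field_simps)
      then have "0 \<le> j" "j \<le> int n" by linarith+
      then show ?thesis using j by (intro exI[of _ "nat j"]) auto
    qed
    then obtain f where f: "\<And>i. f i \<le> n" "\<And>i. z $ i = real (f i)" by metis
    have "x = ?g f" by (simp add: vec_eq_iff x f)
    moreover have "f \<in> ?F" using f(1) by auto
    ultimately show "x \<in> ?g ` ?F" by blast
  qed
  have fin: "finite ?F" by (intro finite_PiE) auto
  show "finite (lattice_cube (1 / real n) :: (real ^ 'n) set)"
    using sub fin by (rule finite_subset[OF _ finite_imageI])
  have "card (lattice_cube (1 / real n) :: (real ^ 'n) set) \<le> card (?g ` ?F)"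
    using sub fin by (intro card_mono finite_imageI) auto
  also have "\<dots> \<le> card ?F" by (rule card_image_le[OF fin])
  also have "\<dots> = (n + 1) ^ CARD('n)" by (simp add: card_PiE)
  finally show "card (lattice_cube (1 / real n) :: (real ^ 'n) set) \<le> (n + 1) ^ CARD('n)" .
qed

lemma countable_crossing_paths:
  fixes k :: "'n::finite"
  assumes "0 < n"
  shows "countable (crossing_paths k (1 / real n))"
proof (rule countable_subset)
  show "crossing_paths k (1 / real n) \<subseteq> lists (lattice_cube (1 / real n))"
    using crossing_path_subset by (fastforce simp: lists_eq_set)
  show "countable (lists (lattice_cube (1 / real n) :: (real ^ 'n) set))"
    using lattice_cube_finite_card(1)[OF assms] by (intro countable_lists countable_finite)
qed

lemma straight_path_crossing:
  fixes k :: "'n::finite"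
  assumes n: "0 < n"
  shows "map (\<lambda>j. (real j / real n) *\<^sub>R axis k 1) [0..<Suc n] \<in> crossing_paths k (1 / real n)"
proof -
  let ?p = "\<lambda>j::nat. (real j / real n) *\<^sub>R axis k 1 :: real ^ 'n"
  let ?P = "map ?p [0..<Suc n]"
  have cube: "?p j \<in> lattice_cube (1 / real n)" if "j \<le> n" for j
  proof -
    have "?p j = (1 / real n) *\<^sub>R (real j *\<^sub>R axis k 1)" by simp
    moreover have "\<forall>i. (real j *\<^sub>R axis k 1 :: real ^ 'n) $ i \<in> \<int>" by (auto simp: axis_def)
    ultimately have "?p j \<in> lattice (1 / real n)" unfolding lattice_def by blast
    moreover have "?p j \<in> cbox 0 (vec 1)" using that n by (auto simp: mem_box_cart axis_def)
    ultimately show ?thesis by (simp add: lattice_cube_def)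
  qed
  have succ: "successively (\<lambda>x y. dist x y = 1 / real n) ?P"
    unfolding successively_conv_nth
  proof (intro allI impI)
    fix i assume i: "Suc i < length ?P"
    have "?p i - ?p (Suc i) = (- 1 / real n) *\<^sub>R axis k 1"
      using n by (simp flip: scaleR_left_diff_distrib add: field_simps)
    then show "dist (?P ! i) (?P ! Suc i) = 1 / real n"
      using i by (simp add: dist_norm nth_map del: upt_Suc)
  qed
  have "?P \<in> lattice_paths (1 / real n) (lattice_cube (1 / real n)) (?p 0) (?p n)"
    using cube succ by (auto simp: lattice_paths_def lattice_cube_def last_map hd_map simp del: upt_Suc)
  moreover have "?p 0 \<in> left_face k (1 / real n)" using cube[of 0] by (simp add: left_face_def)
  moreover have "?p n \<in> right_face k (1 / real n)" using cube[of n] n by (simp add: right_face_def)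
  ultimately show ?thesis unfolding crossing_paths_def by blast
qed

lemma path_displacement:
  fixes P :: "(real ^ 'n) list"
  assumes "P \<noteq> []" "successively (\<lambda>x y. dist x y = \<epsilon>) P"
  shows "last P $ k - hd P $ k + \<epsilon> \<le> real (length P) * \<epsilon>"
  using assms
proof (induction P rule: list_nonempty_induct)
  case (single x)
  then show ?case by simp
next
  case (cons x xs)
  then have step: "dist x (hd xs) = \<epsilon>" and xs: "successively (\<lambda>x y. dist x y = \<epsilon>) xs"
    by (auto simp: successively_Cons)
  have "\<bar>(hd xs - x) $ k\<bar> \<le> norm (hd xs - x)" by (rule component_le_norm_cart)
  then have "hd xs $ k - x $ k \<le> \<epsilon>" using step by (simp add: dist_norm norm_minus_commute)
  then show ?case using cons.IH[OF xs] cons.hyps by (simp add: algebra_simps)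
qed

text \<open>
  Each step advances by at most \<open>1 / n\<close> in direction \<open>k\<close>, so a crossing has at least \<open>n + 1\<close> points.
\<close>

lemma crossing_path_length:
  assumes crossing: "P \<in> crossing_paths k (1 / real n)" and n: "0 < n"
  shows "1 < real (length P) * (1 / real n)"
proof -
  have P: "P \<noteq> []" "hd P $ k = 0" "last P $ k = 1" "successively (\<lambda>x y. dist x y = 1 / real n) P"
    using crossing by (auto simp: crossing_paths_def lattice_paths_def left_face_def right_face_def)
  have "0 < 1 / real n" using n by simp
  then show ?thesis using path_displacement[OF P(1,4), of k] P(2,3) by linarith
qed

section \<open>The exponent in terms of likely crossings\<close>

lemma box_average_eq: "box_average h \<epsilon> \<omega> x = h (box_measure \<epsilon> x, uniform_sphere) \<omega>"
  by (simp add: box_average_def box_measure_def)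

definition crossing_event ::
  "'w measure \<Rightarrow> ((real ^ 'n) signed_pair \<Rightarrow> 'w \<Rightarrow> real) \<Rightarrow> 'n \<Rightarrow> real \<Rightarrow> real \<Rightarrow> nat \<Rightarrow> 'w set" where
  "crossing_event M h k \<xi> \<alpha> n = {\<omega> \<in> space M. \<exists>P\<in>crossing_paths k (1 / real n).
     lfpp_length (1 / real n) \<xi> (box_average h (1 / real n) \<omega>) P \<le> (1 / real n) powr \<alpha>}"

text \<open>
  The exponent is defined through the infimum over all paths. Asking instead for a single path of length at
  most \<open>\<epsilon> powr \<alpha>\<close> changes nothing in the supremum over \<open>\<alpha>\<close> and provides a path to work with. The exponents
  that are likely in this sense form a half-line unbounded below.
\<close>

definition crossing_likely ::
  "'w measure \<Rightarrow> ((real ^ 'n) signed_pair \<Rightarrow> 'w \<Rightarrow> real) \<Rightarrow> 'n \<Rightarrow> real \<Rightarrow> real \<Rightarrow> bool" where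
  "crossing_likely M h k \<xi> \<alpha> \<longleftrightarrow> (\<lambda>n. measure M (crossing_event M h k \<xi> \<alpha> n)) \<longlonglongrightarrow> 1"

lemma lfpp_length_nonneg: "0 < \<epsilon> \<Longrightarrow> 0 \<le> lfpp_length \<epsilon> \<xi> \<phi> P"
  unfolding lfpp_length_def by (intro sum_list_nonneg) auto

lemma powr_antimono_base_le_1:
  fixes e :: real
  assumes "0 < e" "e \<le> 1" "a \<le> b"
  shows "e powr b \<le> e powr a"
  using assms powr_mono'[of a b e] by simp

lemma prob_tendsto_1_mono:
  assumes M: "prob_space M" and p: "p \<longlonglongrightarrow> (1::real)" and r: "r \<longlonglongrightarrow> 0"
    and le: "eventually (\<lambda>n. p n - r n \<le> measure M (A n)) sequentially"
  shows "(\<lambda>n. measure M (A n)) \<longlonglongrightarrow> 1"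
proof (rule tendsto_sandwich[of "\<lambda>n. p n - r n" _ _ "\<lambda>_. 1"])
  show "(\<lambda>n. p n - r n) \<longlonglongrightarrow> 1" using tendsto_diff[OF p r] by simp
  interpret prob_space M by fact
  show "\<forall>\<^sub>F n in sequentially. measure M (A n) \<le> 1" by simp
qed (use le in auto)

lemma sum_list_measurable:
  assumes "\<And>x. x \<in> set P \<Longrightarrow> f x \<in> borel_measurable N"
  shows "(\<lambda>\<omega>. \<Sum>x\<leftarrow>P. f x \<omega> :: real) \<in> borel_measurable N"
  using assms by (induction P) auto

lemma nn_integral_sum_list_le:
  fixes g :: "'b \<Rightarrow> 'a \<Rightarrow> real" and w :: "'b \<Rightarrow> real"
  assumes "\<And>x. x \<in> set P \<Longrightarrow> g x \<in> borel_measurable M" "\<And>x \<omega>. 0 \<le> g x \<omega>" "\<And>x. 0 \<le> w x"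
    and "\<And>x. x \<in> set P \<Longrightarrow> (\<integral>\<^sup>+\<omega>. ennreal (g x \<omega>) \<partial>M) \<le> ennreal m" and m: "0 \<le> m"
  shows "(\<integral>\<^sup>+\<omega>. ennreal (\<Sum>x\<leftarrow>P. w x * g x \<omega>) \<partial>M) \<le> ennreal (m * (\<Sum>x\<leftarrow>P. w x))"
  using assms(1,4)
proof (induction P)
  case (Cons x P)
  have nonneg: "0 \<le> (\<Sum>x\<leftarrow>P. w x * g x \<omega>)" "0 \<le> (\<Sum>x\<leftarrow>P. w x)" for \<omega>
    using assms(2,3) by (auto intro!: sum_list_nonneg)
  have [measurable]: "g x \<in> borel_measurable M" "(\<lambda>\<omega>. \<Sum>x\<leftarrow>P. w x * g x \<omega>) \<in> borel_measurable M"
    using Cons.prems(1) by (auto intro!: sum_list_measurable)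
  have "(\<integral>\<^sup>+\<omega>. ennreal (\<Sum>x\<leftarrow>x # P. w x * g x \<omega>) \<partial>M) =
      (\<integral>\<^sup>+\<omega>. ennreal (w x) * ennreal (g x \<omega>) + ennreal (\<Sum>x\<leftarrow>P. w x * g x \<omega>) \<partial>M)"
    using assms(2,3) nonneg by (simp add: ennreal_mult)
  also have "\<dots> = ennreal (w x) * (\<integral>\<^sup>+\<omega>. ennreal (g x \<omega>) \<partial>M) + (\<integral>\<^sup>+\<omega>. ennreal (\<Sum>x\<leftarrow>P. w x * g x \<omega>) \<partial>M)"
    by (simp add: nn_integral_add nn_integral_cmult)
  also have "\<dots> \<le> ennreal (w x) * ennreal m + ennreal (m * (\<Sum>x\<leftarrow>P. w x))"
    using Cons by (intro add_mono mult_left_mono) auto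
  also have "\<dots> = ennreal (m * (\<Sum>x\<leftarrow>x # P. w x))"
    using assms(3) m nonneg by (simp add: ennreal_mult'[symmetric] flip: ennreal_plus) (simp add: algebra_simps)
  finally show ?case .
qed simp

lemma (in prob_space) liminf_prob_eq_1_iff:
  "liminf (\<lambda>n. ereal (measure M (A n))) = 1 \<longleftrightarrow> (\<lambda>n. measure M (A n)) \<longlonglongrightarrow> 1"
proof
  assume L: "liminf (\<lambda>n. ereal (measure M (A n))) = 1"
  have "limsup (\<lambda>n. ereal (measure M (A n))) \<le> 1"
    by (intro Limsup_bounded) (simp add: one_ereal_def)
  moreover have "liminf (\<lambda>n. ereal (measure M (A n))) \<le> limsup (\<lambda>n. ereal (measure M (A n)))"
    by (rule Liminf_le_Limsup) simp
  ultimately have "(\<lambda>n. ereal (measure M (A n))) \<longlonglongrightarrow> 1"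
    using L by (simp add: tendsto_iff_Liminf_eq_Limsup)
  then show "(\<lambda>n. measure M (A n)) \<longlonglongrightarrow> 1" by (simp add: one_ereal_def)
next
  assume "(\<lambda>n. measure M (A n)) \<longlonglongrightarrow> 1"
  then have "(\<lambda>n. ereal (measure M (A n))) \<longlonglongrightarrow> ereal 1" by simp
  then show "liminf (\<lambda>n. ereal (measure M (A n))) = 1"
    using lim_imp_Liminf[of sequentially "\<lambda>n. ereal (measure M (A n))" "ereal 1"] by (simp add: one_ereal_def)
qed

text \<open>
  The constant \<open>C\<close> bounds the variance of the mollified field uniformly in \<open>\<epsilon>\<close> and \<open>x\<close>; being a
  parameter, it can be fixed once for all estimates.
\<close>

locale lfpp =
  fixes M :: "'w measure" and h :: "(real ^ 'n) signed_pair \<Rightarrow> 'w \<Rightarrow> real" and k :: 'n and C :: real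
  assumes field: "log_correlated_field M h"
    and C: "0 < C"
    and index: "\<And>\<epsilon> (x :: real ^ 'n). 0 < \<epsilon> \<Longrightarrow> \<epsilon> \<le> 1 \<Longrightarrow> x \<in> cbox 0 (vec 1) \<Longrightarrow>
      (box_measure \<epsilon> x, uniform_sphere) \<in> mass_zero_finite_energy \<and>
      log_covariance (box_measure \<epsilon> x, uniform_sphere) (box_measure \<epsilon> x, uniform_sphere) \<le> ln (1 / \<epsilon>) + C"
begin

sublocale prob_space M by (rule field_prob_space[OF field])

lemma index_cube:
  fixes x :: "real ^ 'n"
  assumes "0 < n" "x \<in> lattice_cube (1 / real n)"
  shows "(box_measure (1 / real n) x, uniform_sphere) \<in> mass_zero_finite_energy"
    and "log_covariance (box_measure (1 / real n) x, uniform_sphere) (box_measure (1 / real n) x, uniform_sphere)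
      \<le> ln (real n) + C"
  using index[of "1 / real n" x] assms by (auto simp: lattice_cube_def)

lemma box_average_gaussian:
  fixes x :: "real ^ 'n"
  assumes "0 < n" "x \<in> lattice_cube (1 / real n)"
  shows "centered_gaussian M (\<lambda>\<omega>. box_average h (1 / real n) \<omega> x)"
    and "(\<integral>\<omega>. (box_average h (1 / real n) \<omega> x)\<^sup>2 \<partial>M) \<le> ln (real n) + C"
  using index_cube[OF assms] field_gaussian[OF field] field_second_moment[OF field]
  by (auto simp: box_average_eq)

lemma box_average_measurable:
  "0 < n \<Longrightarrow> x \<in> lattice_cube (1 / real n) \<Longrightarrow> (\<lambda>\<omega>. box_average h (1 / real n) \<omega> x) \<in> borel_measurable M"
  using box_average_gaussian(1) by (simp add: centered_gaussian_def)

lemma lfpp_length_measurable: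
  assumes "0 < n" "P \<in> crossing_paths k (1 / real n)"
  shows "(\<lambda>\<omega>. lfpp_length (1 / real n) \<xi> (box_average h (1 / real n) \<omega>) P) \<in> borel_measurable M"
  unfolding lfpp_length_def
  using crossing_path_subset[OF assms(2)] box_average_measurable[OF assms(1)]
  by (intro sum_list_measurable) auto

lemma crossing_event_sets:
  assumes n: "0 < n"
  shows "crossing_event M h k \<xi> \<alpha> n \<in> sets M"
proof -
  have "crossing_event M h k \<xi> \<alpha> n = (\<Union>P\<in>crossing_paths k (1 / real n). {\<omega>\<in>space M.
      lfpp_length (1 / real n) \<xi> (box_average h (1 / real n) \<omega>) P \<le> (1 / real n) powr \<alpha>})"
    by (auto simp: crossing_event_def)
  also have "\<dots> \<in> sets M"
    using lfpp_length_measurable[OF n]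
    by (intro sets.countable_UN'' countable_crossing_paths n borel_measurable_le) auto
  finally show ?thesis .
qed

lemma crossing_likely_antimono:
  assumes "crossing_likely M h k \<xi> \<alpha>" "\<beta> \<le> \<alpha>"
  shows "crossing_likely M h k \<xi> \<beta>"
  unfolding crossing_likely_def
proof (rule prob_tendsto_1_mono[OF prob_space_axioms])
  show "(\<lambda>n. measure M (crossing_event M h k \<xi> \<alpha> n)) \<longlonglongrightarrow> 1"
    using assms(1) by (simp add: crossing_likely_def)
  show "\<forall>\<^sub>F n in sequentially. measure M (crossing_event M h k \<xi> \<alpha> n) - 0 \<le> measure M (crossing_event M h k \<xi> \<beta> n)"
    using eventually_gt_at_top[of 0]
  proof eventually_elim
    case (elim n)
    have "(1 / real n) powr \<alpha> \<le> (1 / real n) powr \<beta>"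
      using elim assms(2) by (intro powr_antimono_base_le_1) auto
    then have "crossing_event M h k \<xi> \<alpha> n \<subseteq> crossing_event M h k \<xi> \<beta> n"
      unfolding crossing_event_def by (blast intro: order_trans)
    then show ?case using crossing_event_sets[OF elim] by (simp add: finite_measure_mono)
  qed
qed simp

abbreviation short_dist_event :: "real \<Rightarrow> real \<Rightarrow> nat \<Rightarrow> 'w set" where
  "short_dist_event \<xi> \<alpha> n \<equiv> {\<omega> \<in> space M. lfpp_set_dist (1 / real n) \<xi> (box_average h (1 / real n) \<omega>)
     (lattice_cube (1 / real n)) (left_face k (1 / real n)) (right_face k (1 / real n)) \<le> ennreal ((1 / real n) powr \<alpha>)}"

lemma short_dist_event_sets:
  assumes n: "0 < n"
  shows "short_dist_event \<xi> \<alpha> n \<in> sets M"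
proof -
  have "(\<lambda>\<omega>. INF P\<in>crossing_paths k (1 / real n). ennreal (lfpp_length (1 / real n) \<xi> (box_average h (1 / real n) \<omega>) P)) \<in> borel_measurable M"
    using lfpp_length_measurable[OF n]
    by (intro borel_measurable_INF countable_crossing_paths n measurable_compose[OF _ measurable_ennreal]) auto
  then show ?thesis unfolding lfpp_set_dist_crossing by measurable
qed

lemma crossing_event_subset:
  assumes "0 < n"
  shows "crossing_event M h k \<xi> \<alpha> n \<subseteq> short_dist_event \<xi> \<alpha> n"
  unfolding crossing_event_def lfpp_set_dist_crossing
  by (auto intro!: INF_lower2 ennreal_leI)

text \<open>
  Since \<open>\<beta> < \<alpha>\<close>, the infimum lies strictly below \<open>(1 / n) powr \<beta>\<close>, so some path does, whether or not the
  infimum is attained.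
\<close>

lemma short_dist_event_subset:
  assumes "1 < n" "\<beta> < \<alpha>"
  shows "short_dist_event \<xi> \<alpha> n \<subseteq> crossing_event M h k \<xi> \<beta> n"
proof
  fix \<omega> assume w: "\<omega> \<in> short_dist_event \<xi> \<alpha> n"
  have "(1 / real n) powr \<alpha> < (1 / real n) powr \<beta>"
    using assms powr_less_mono'[of "1 / real n" \<beta> \<alpha>] by simp
  then have "ennreal ((1 / real n) powr \<alpha>) < ennreal ((1 / real n) powr \<beta>)"
    by (simp add: ennreal_less_iff)
  then have "(INF P\<in>crossing_paths k (1 / real n). ennreal (lfpp_length (1 / real n) \<xi> (box_average h (1 / real n) \<omega>) P))
      < ennreal ((1 / real n) powr \<beta>)"
    using w unfolding lfpp_set_dist_crossing by auto
  then obtain P where P: "P \<in> crossing_paths k (1 / real n)"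
    "ennreal (lfpp_length (1 / real n) \<xi> (box_average h (1 / real n) \<omega>) P) < ennreal ((1 / real n) powr \<beta>)"
    by (auto simp: INF_less_iff)
  then have "lfpp_length (1 / real n) \<xi> (box_average h (1 / real n) \<omega>) P \<le> (1 / real n) powr \<beta>"
    using assms by (simp add: ennreal_less_iff[OF lfpp_length_nonneg])
  then show "\<omega> \<in> crossing_event M h k \<xi> \<beta> n" using P(1) w by (auto simp: crossing_event_def)
qed

lemma distance_exponent_eq_Sup_likely:
  "distance_exponent M h k \<xi> = Sup (ereal ` {\<alpha>. crossing_likely M h k \<xi> \<alpha>})"
proof -
  let ?S = "{\<alpha>. (\<lambda>n. measure M (short_dist_event \<xi> \<alpha> n)) \<longlonglongrightarrow> 1}"
  have "distance_exponent M h k \<xi> = Sup (ereal ` ?S)"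
    unfolding distance_exponent_def Let_def liminf_prob_eq_1_iff by (rule arg_cong[of _ _ Sup]) auto
  also have "\<dots> = Sup (ereal ` {\<alpha>. crossing_likely M h k \<xi> \<alpha>})"
  proof (rule antisym)
    show "Sup (ereal ` ?S) \<le> Sup (ereal ` {\<alpha>. crossing_likely M h k \<xi> \<alpha>})"
    proof (rule SUP_least)
      fix \<alpha> assume \<alpha>: "\<alpha> \<in> ?S"
      show "ereal \<alpha> \<le> Sup (ereal ` {\<alpha>. crossing_likely M h k \<xi> \<alpha>})"
      proof (rule dense_le)
        fix y assume "y < ereal \<alpha>"
        then obtain \<beta> where \<beta>: "y < ereal \<beta>" "ereal \<beta> < ereal \<alpha>" using ereal_dense2 by blast
        have "crossing_likely M h k \<xi> \<beta>"
          unfolding crossing_likely_def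
        proof (rule prob_tendsto_1_mono[OF prob_space_axioms])
          show "(\<lambda>n. measure M (short_dist_event \<xi> \<alpha> n)) \<longlonglongrightarrow> 1" using \<alpha> by simp
          show "\<forall>\<^sub>F n in sequentially. measure M (short_dist_event \<xi> \<alpha> n) - 0 \<le> measure M (crossing_event M h k \<xi> \<beta> n)"
            using eventually_gt_at_top[of 1]
          proof eventually_elim
            case (elim n)
            then show ?case
              using short_dist_event_subset[of n \<beta> \<alpha> \<xi>] \<beta> crossing_event_sets[of n \<xi> \<beta>]
              by (simp add: finite_measure_mono)
          qed
        qed simp
        then have "ereal \<beta> \<le> Sup (ereal ` {\<alpha>. crossing_likely M h k \<xi> \<alpha>})" by (intro SUP_upper) simp
        then show "y \<le> Sup (ereal ` {\<alpha>. crossing_likely M h k \<xi> \<alpha>})" using \<beta>(1) by simp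
      qed
    qed
    show "Sup (ereal ` {\<alpha>. crossing_likely M h k \<xi> \<alpha>}) \<le> Sup (ereal ` ?S)"
    proof (intro Sup_subset_mono image_mono subsetI CollectI)
      fix \<alpha> assume "\<alpha> \<in> {\<alpha>. crossing_likely M h k \<xi> \<alpha>}"
      then have \<alpha>: "(\<lambda>n. measure M (crossing_event M h k \<xi> \<alpha> n)) \<longlonglongrightarrow> 1" by (simp add: crossing_likely_def)
      show "(\<lambda>n. measure M (short_dist_event \<xi> \<alpha> n)) \<longlonglongrightarrow> 1"
      proof (rule prob_tendsto_1_mono[OF prob_space_axioms \<alpha>])
        show "\<forall>\<^sub>F n in sequentially. measure M (crossing_event M h k \<xi> \<alpha> n) - 0 \<le> measure M (short_dist_event \<xi> \<alpha> n)"
          using eventually_gt_at_top[of 0]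
          by eventually_elim
            (simp add: finite_measure_mono[OF crossing_event_subset short_dist_event_sets])
      qed simp
    qed
  qed
  finally show ?thesis .
qed

lemma likely_zero_neg:
  assumes "\<alpha> < 0"
  shows "crossing_likely M h k 0 \<alpha>"
  unfolding crossing_likely_def
proof (rule prob_tendsto_1_mono[OF prob_space_axioms tendsto_const[of 1] tendsto_const[of 0]])
  have "filterlim (\<lambda>n. real n powr (- \<alpha>)) at_top sequentially"
    using assms by real_asymp
  then have "\<forall>\<^sub>F n in sequentially. 2 \<le> real n powr (- \<alpha>)"
    by (simp add: filterlim_at_top)
  then show "\<forall>\<^sub>F n in sequentially. 1 - 0 \<le> measure M (crossing_event M h k 0 \<alpha> n)"
    using eventually_gt_at_top[of 0]
  proof eventually_elim
    case (elim n)
    let ?P = "map (\<lambda>j. (real j / real n) *\<^sub>R axis k 1 :: real ^ 'n) [0..<Suc n]"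
    have "lfpp_length (1 / real n) 0 \<phi> ?P \<le> (1 / real n) powr \<alpha>" for \<phi>
    proof -
      have "lfpp_length (1 / real n) 0 \<phi> ?P = real (Suc n) * (1 / real n)"
        by (simp add: lfpp_length_def sum_list_triv o_def del: upt_Suc)
      also have "\<dots> \<le> 2" using elim by (simp add: field_simps)
      also have "\<dots> \<le> real n powr (- \<alpha>)" by (rule elim)
      also have "\<dots> = (1 / real n) powr \<alpha>" using elim by (simp add: powr_divide powr_minus field_simps)
      finally show ?thesis .
    qed
    then have "crossing_event M h k 0 \<alpha> n = space M"
      using straight_path_crossing[of n k] elim by (auto simp: crossing_event_def simp del: upt_Suc)
    then show ?case by (simp add: prob_space)
  qed
qed

lemma not_likely_zero_pos:
  assumes "0 < \<alpha>"
  shows "\<not> crossing_likely M h k 0 \<alpha>"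
proof
  assume "crossing_likely M h k 0 \<alpha>"
  then have "(\<lambda>n. measure M (crossing_event M h k 0 \<alpha> n)) \<longlonglongrightarrow> 1" by (simp add: crossing_likely_def)
  moreover have "\<forall>\<^sub>F n in sequentially. measure M (crossing_event M h k 0 \<alpha> n) = 0"
    using eventually_gt_at_top[of 0]
  proof eventually_elim
    case (elim n)
    have "(1 / real n) powr \<alpha> \<le> (1 / real n) powr 0"
      using elim assms by (intro powr_antimono_base_le_1) auto
    then have small: "(1 / real n) powr \<alpha> \<le> 1" using elim by simp
    have "crossing_event M h k 0 \<alpha> n = {}"
    proof -
      have "\<not> lfpp_length (1 / real n) 0 \<phi> P \<le> (1 / real n) powr \<alpha>"
        if "P \<in> crossing_paths k (1 / real n)" for \<phi> P
        using crossing_path_length[OF that elim] small by (simp add: lfpp_length_def sum_list_triv)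
      then show ?thesis by (auto simp: crossing_event_def)
    qed
    then show ?case by simp
  qed
  then have "(\<lambda>n. measure M (crossing_event M h k 0 \<alpha> n)) \<longlonglongrightarrow> 0"
    by (simp add: tendsto_eventually)
  ultimately show False using LIMSEQ_unique by fastforce
qed

end

section \<open>The maximum of the field and the effect of independent noise\<close>

context lfpp
begin

text \<open>
  A union bound over the at most \<open>(n + 1) ^ d\<close> lattice points. The Gaussian tail at \<open>c * ln n\<close> with
  variance \<open>ln n + C\<close> is of order \<open>n powr (- c\<^sup>2 / 2)\<close>, and \<open>c\<^sup>2 / 2 > d\<close>.
\<close>

lemma max_box_average:
  assumes c: "sqrt (2 * real CARD('n)) < c"
  shows "(\<lambda>n. measure M {\<omega>\<in>space M. \<exists>x\<in>lattice_cube (1 / real n). c * ln (real n) \<le> \<bar>box_average h (1 / real n) \<omega> x\<bar>}) \<longlonglongrightarrow> 0"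
    (is "(\<lambda>n. measure M (?B n)) \<longlonglongrightarrow> 0")
proof -
  define d where "d = CARD('n)"
  have c0: "0 < c" using c by (rule le_less_trans[rotated]) simp
  have c2: "real d < c\<^sup>2 / 2"
  proof -
    have "(sqrt (2 * real d))\<^sup>2 < c\<^sup>2" using c by (intro power_strict_mono) (auto simp: d_def)
    then show ?thesis by simp
  qed
  define K where "K = 2 * 2 ^ d * exp (c\<^sup>2 / 2 * C)"
  have bound: "measure M (?B n) \<le> K * exp (- ((c\<^sup>2 / 2 - real d) * ln (real n)))" if n: "0 < n" for n
  proof -
    let ?S = "lattice_cube (1 / real n) :: (real ^ 'n) set"
    let ?L = "ln (real n)"
    have L: "0 \<le> ?L" using n by simp
    have B: "?B n = (\<Union>x\<in>?S. {\<omega>\<in>space M. c * ?L \<le> \<bar>box_average h (1 / real n) \<omega> x\<bar>})" by auto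
    have "measure M (?B n) \<le> (\<Sum>x\<in>?S. measure M {\<omega>\<in>space M. c * ?L \<le> \<bar>box_average h (1 / real n) \<omega> x\<bar>})"
      unfolding B
      using box_average_measurable[OF n] lattice_cube_finite_card(1)[OF n]
      by (intro finite_measure_subadditive_finite) auto
    also have "\<dots> \<le> (\<Sum>x\<in>?S. 2 * exp (- (c * ?L)\<^sup>2 / (2 * (?L + C))))"
      using box_average_gaussian[OF n] C L c0
      by (intro sum_mono centered_gaussian_tail[OF prob_space_axioms]) auto
    also have "\<dots> = real (card ?S) * (2 * exp (- (c * ?L)\<^sup>2 / (2 * (?L + C))))" by simp
    also have "\<dots> \<le> (2 ^ d * exp (real d * ?L)) * (2 * exp (- (c\<^sup>2 / 2 * (?L - C))))"
    proof (rule mult_mono)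
      have "real (card ?S) \<le> real ((n + 1) ^ d)"
        using lattice_cube_finite_card(2)[OF n, where 'n = 'n] by (simp add: d_def del: of_nat_power of_nat_add)
      also have "\<dots> = (real n + 1) ^ d" by (simp add: add.commute)
      also have "\<dots> \<le> (2 * real n) ^ d" using n by (intro power_mono) auto
      also have "\<dots> = 2 ^ d * exp (real d * ?L)"
        using n by (simp add: power_mult_distrib exp_of_nat_mult)
      finally show "real (card ?S) \<le> 2 ^ d * exp (real d * ?L)" .
      \<comment> \<open>The constant \<open>C\<close> in the variance costs only the factor \<open>exp (c\<^sup>2 / 2 * C)\<close> in the tail.\<close>
      have "(?L - C) * (?L + C) \<le> ?L\<^sup>2" by (simp add: algebra_simps power2_eq_square)
      then have "?L - C \<le> ?L\<^sup>2 / (?L + C)" using C L by (simp add: pos_le_divide_eq)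
      then have "c\<^sup>2 / 2 * (?L - C) \<le> c\<^sup>2 / 2 * (?L\<^sup>2 / (?L + C))" by (intro mult_left_mono) auto
      then show "2 * exp (- (c * ?L)\<^sup>2 / (2 * (?L + C))) \<le> 2 * exp (- (c\<^sup>2 / 2 * (?L - C)))"
        by (simp add: power_mult_distrib)
    qed auto
    also have "\<dots> = K * exp (- ((c\<^sup>2 / 2 - real d) * ?L))"
    proof -
      have "real d * ?L + - (c\<^sup>2 / 2 * (?L - C)) = c\<^sup>2 / 2 * C + - ((c\<^sup>2 / 2 - real d) * ?L)"
        by (simp add: field_simps)
      then have "exp (real d * ?L) * exp (- (c\<^sup>2 / 2 * (?L - C))) = exp (c\<^sup>2 / 2 * C) * exp (- ((c\<^sup>2 / 2 - real d) * ?L))"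
        by (simp only: exp_add[symmetric])
      then show ?thesis by (simp add: K_def)
    qed
    finally show ?thesis .
  qed
  have "(\<lambda>n. K * exp (- ((c\<^sup>2 / 2 - real d) * ln (real n)))) \<longlonglongrightarrow> 0"
  proof -
    have "(\<lambda>n. K * exp (- (e * ln (real n)))) \<longlonglongrightarrow> 0" if "0 < e" for e
      using that by real_asymp
    then show ?thesis using c2 by simp
  qed
  then show ?thesis
    by (rule tendsto_sandwich[rotated 2, OF tendsto_const])
      (auto intro!: eventually_mono[OF eventually_gt_at_top[of 0]] bound)
qed

text \<open>
  Unless the field is exceptionally large somewhere, one and the same path is short for both parameters.
\<close>

lemma likely_shift:
  assumes \<xi>: "crossing_likely M h k \<xi> \<alpha>" and c: "sqrt (2 * real CARD('n)) < c"
  shows "crossing_likely M h k \<xi>' (\<alpha> - \<bar>\<xi>' - \<xi>\<bar> * c)"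
  unfolding crossing_likely_def
proof (rule prob_tendsto_1_mono[OF prob_space_axioms _ max_box_average[OF c]])
  show "(\<lambda>n. measure M (crossing_event M h k \<xi> \<alpha> n)) \<longlonglongrightarrow> 1" using \<xi> by (simp add: crossing_likely_def)
  let ?B = "\<lambda>n. {\<omega>\<in>space M. \<exists>x\<in>lattice_cube (1 / real n). c * ln (real n) \<le> \<bar>box_average h (1 / real n) \<omega> x\<bar>}"
  show "\<forall>\<^sub>F n in sequentially. measure M (crossing_event M h k \<xi> \<alpha> n) - measure M (?B n)
      \<le> measure M (crossing_event M h k \<xi>' (\<alpha> - \<bar>\<xi>' - \<xi>\<bar> * c) n)"
    using eventually_gt_at_top[of 0]
  proof eventually_elim
    case (elim n)
    have c0: "0 < c" using c by (rule le_less_trans[rotated]) simp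
    have B: "?B n \<in> sets M"
    proof -
      have "?B n = (\<Union>x\<in>lattice_cube (1 / real n). {\<omega>\<in>space M. c * ln (real n) \<le> \<bar>box_average h (1 / real n) \<omega> x\<bar>})" by auto
      also have "\<dots> \<in> sets M"
        using box_average_measurable[OF elim] lattice_cube_finite_card(1)[OF elim]
        by (intro sets.finite_UN) auto
      finally show ?thesis .
    qed
    have "crossing_event M h k \<xi> \<alpha> n \<subseteq> ?B n \<union> crossing_event M h k \<xi>' (\<alpha> - \<bar>\<xi>' - \<xi>\<bar> * c) n"
    proof
      fix \<omega> assume "\<omega> \<in> crossing_event M h k \<xi> \<alpha> n"
      then obtain P where w: "\<omega> \<in> space M" and P: "P \<in> crossing_paths k (1 / real n)"
        and len: "lfpp_length (1 / real n) \<xi> (box_average h (1 / real n) \<omega>) P \<le> (1 / real n) powr \<alpha>"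
        by (auto simp: crossing_event_def)
      show "\<omega> \<in> ?B n \<union> crossing_event M h k \<xi>' (\<alpha> - \<bar>\<xi>' - \<xi>\<bar> * c) n"
      proof (cases "\<omega> \<in> ?B n")
        case False
        let ?\<phi> = "box_average h (1 / real n) \<omega>"
        let ?m = "real n powr (\<bar>\<xi>' - \<xi>\<bar> * c)"
        have weight: "(1 / real n) * exp (\<xi>' * ?\<phi> x) \<le> ?m * ((1 / real n) * exp (\<xi> * ?\<phi> x))" if x: "x \<in> set P" for x
        proof -
          have small: "\<bar>?\<phi> x\<bar> \<le> c * ln (real n)"
            using False w x crossing_path_subset[OF P] by (auto simp: not_le intro: less_imp_le)
          have "(\<xi>' - \<xi>) * ?\<phi> x \<le> \<bar>\<xi>' - \<xi>\<bar> * \<bar>?\<phi> x\<bar>"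
            by (metis abs_ge_self abs_mult)
          also have "\<dots> \<le> \<bar>\<xi>' - \<xi>\<bar> * (c * ln (real n))" by (intro mult_left_mono small) auto
          finally have "\<xi>' * ?\<phi> x \<le> \<bar>\<xi>' - \<xi>\<bar> * c * ln (real n) + \<xi> * ?\<phi> x" by (simp add: algebra_simps)
          then have "exp (\<xi>' * ?\<phi> x) \<le> exp (\<bar>\<xi>' - \<xi>\<bar> * c * ln (real n)) * exp (\<xi> * ?\<phi> x)"
            by (simp flip: exp_add)
          also have "exp (\<bar>\<xi>' - \<xi>\<bar> * c * ln (real n)) = ?m" using elim by (simp add: powr_def)
          finally show ?thesis by (simp add: divide_right_mono)
        qed
        have "lfpp_length (1 / real n) \<xi>' ?\<phi> P \<le> ?m * lfpp_length (1 / real n) \<xi> ?\<phi> P"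
          unfolding lfpp_length_def sum_list_const_mult[symmetric] by (intro sum_list_mono weight)
        also have "\<dots> \<le> ?m * (1 / real n) powr \<alpha>" using len by (intro mult_left_mono) auto
        also have "\<dots> = (1 / real n) powr (\<alpha> - \<bar>\<xi>' - \<xi>\<bar> * c)"
          using elim by (simp add: powr_diff powr_divide)
        finally show ?thesis using w P by (auto simp: crossing_event_def)
      qed simp
    qed
    then have "measure M (crossing_event M h k \<xi> \<alpha> n) \<le> measure M (?B n \<union> crossing_event M h k \<xi>' (\<alpha> - \<bar>\<xi>' - \<xi>\<bar> * c) n)"
      using B crossing_event_sets[OF elim] by (intro finite_measure_mono) auto
    also have "\<dots> \<le> measure M (?B n) + measure M (crossing_event M h k \<xi>' (\<alpha> - \<bar>\<xi>' - \<xi>\<bar> * c) n)"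
      using B crossing_event_sets[OF elim] by (intro measure_Un_le) auto
    finally show ?case by simp
  qed
qed

text \<open>
  The path \<open>P\<close> and the values \<open>\<phi>\<close> are fixed, and only the noise is random. Each factor \<open>exp (\<xi>' * b * h)\<close> has mean at
  most \<open>exp (\<kappa> * (ln n + C))\<close>, hence so does the whole length relative to that for \<open>\<phi>\<close>, and Markov's
  inequality applies.
\<close>

lemma fresh_noise_cost:
  fixes a b \<xi> \<xi>' :: real
  assumes n: "0 < n" and P: "P \<in> crossing_paths k (1 / real n)" and \<xi>: "\<xi> = \<xi>' * a"
    and len: "lfpp_length (1 / real n) \<xi> \<phi> P \<le> (1 / real n) powr \<alpha>"
    and \<kappa>: "\<kappa> = (\<xi>' * b)\<^sup>2 / 2"
  shows "measure M {\<omega>\<in>space M. \<not> lfpp_length (1 / real n) \<xi>' (\<lambda>x. a * \<phi> x + b * box_average h (1 / real n) \<omega> x) P \<le> (1 / real n) powr \<beta>}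
    \<le> exp (\<kappa> * C) * (1 / real n) powr (\<alpha> - \<kappa> - \<beta>)"
proof -
  let ?e = "1 / real n"
  let ?m = "exp (\<kappa> * (ln (real n) + C))"
  define g where "g = (\<lambda>x \<omega>. exp (\<xi>' * b * box_average h ?e \<omega> x))"
  define w where "w = (\<lambda>x. ?e * exp (\<xi> * \<phi> x))"
  have e: "0 < ?e" using n by simp
  have eq: "lfpp_length ?e \<xi>' (\<lambda>x. a * \<phi> x + b * box_average h ?e \<omega> x) P = (\<Sum>x\<leftarrow>P. w x * g x \<omega>)" for \<omega>
    unfolding lfpp_length_def g_def w_def \<xi> by (simp add: exp_add[symmetric] algebra_simps)
  have gm: "g x \<in> borel_measurable M" if "x \<in> set P" for x
    using box_average_measurable[OF n, of x] that crossing_path_subset[OF P] by (auto simp: g_def)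
  have sm [measurable]: "(\<lambda>\<omega>. \<Sum>x\<leftarrow>P. w x * g x \<omega>) \<in> borel_measurable M"
    using gm by (intro sum_list_measurable) auto
  have "(\<integral>\<^sup>+\<omega>. ennreal (\<Sum>x\<leftarrow>P. w x * g x \<omega>) \<partial>M) \<le> ennreal (?m * (\<Sum>x\<leftarrow>P. w x))"
  proof (rule nn_integral_sum_list_le[OF gm])
    fix x assume "x \<in> set P"
    then have x: "x \<in> lattice_cube ?e" using crossing_path_subset[OF P] by auto
    have "(\<integral>\<^sup>+\<omega>. ennreal (g x \<omega>) \<partial>M) = ennreal (exp ((\<xi>' * b)\<^sup>2 * (\<integral>\<omega>. (box_average h ?e \<omega> x)\<^sup>2 \<partial>M) / 2))"
      unfolding g_def by (rule centered_gaussian_exp_moment[OF prob_space_axioms box_average_gaussian(1)[OF n x]])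
    also have "\<dots> \<le> ennreal ?m"
      using mult_left_mono[OF box_average_gaussian(2)[OF n x], of "(\<xi>' * b)\<^sup>2 / 2"]
      by (intro ennreal_leI) (simp add: \<kappa>)
    finally show "(\<integral>\<^sup>+\<omega>. ennreal (g x \<omega>) \<partial>M) \<le> ennreal ?m" .
  qed (auto simp: g_def w_def)
  also have "\<dots> \<le> ennreal (?m * ?e powr \<alpha>)"
    using len by (intro ennreal_leI mult_left_mono) (auto simp: lfpp_length_def w_def)
  finally have mean: "(\<integral>\<^sup>+\<omega>. ennreal (\<Sum>x\<leftarrow>P. w x * g x \<omega>) \<partial>M) \<le> ennreal (?m * ?e powr \<alpha>)" .
  have "emeasure M {\<omega>\<in>space M. \<not> (\<Sum>x\<leftarrow>P. w x * g x \<omega>) \<le> ?e powr \<beta>} \<le>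
      emeasure M {\<omega>\<in>space M. 1 \<le> ennreal (?e powr (- \<beta>)) * ennreal (\<Sum>x\<leftarrow>P. w x * g x \<omega>)}"
  proof (rule emeasure_mono)
    show "{\<omega>\<in>space M. \<not> (\<Sum>x\<leftarrow>P. w x * g x \<omega>) \<le> ?e powr \<beta>} \<subseteq> {\<omega>\<in>space M. 1 \<le> ennreal (?e powr (- \<beta>)) * ennreal (\<Sum>x\<leftarrow>P. w x * g x \<omega>)}"
    proof safe
      fix \<omega> assume "\<not> (\<Sum>x\<leftarrow>P. w x * g x \<omega>) \<le> ?e powr \<beta>"
      then have "?e powr (- \<beta>) * ?e powr \<beta> \<le> ?e powr (- \<beta>) * (\<Sum>x\<leftarrow>P. w x * g x \<omega>)"
        by (intro mult_left_mono) auto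
      moreover have "?e powr (- \<beta>) * ?e powr \<beta> = 1" using e by (simp flip: powr_add)
      ultimately have "1 \<le> ?e powr (- \<beta>) * (\<Sum>x\<leftarrow>P. w x * g x \<omega>)" by simp
      then show "1 \<le> ennreal (?e powr (- \<beta>)) * ennreal (\<Sum>x\<leftarrow>P. w x * g x \<omega>)"
        by (simp add: ennreal_mult'[symmetric])
    qed
  qed measurable
  also have "\<dots> \<le> ennreal (?e powr (- \<beta>)) * (\<integral>\<^sup>+\<omega>. ennreal (\<Sum>x\<leftarrow>P. w x * g x \<omega>) * indicator (space M) \<omega> \<partial>M)"
    by (rule nn_integral_Markov_inequality) auto
  also have "(\<integral>\<^sup>+\<omega>. ennreal (\<Sum>x\<leftarrow>P. w x * g x \<omega>) * indicator (space M) \<omega> \<partial>M) = (\<integral>\<^sup>+\<omega>. ennreal (\<Sum>x\<leftarrow>P. w x * g x \<omega>) \<partial>M)"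
    by (intro nn_integral_cong) auto
  also have "ennreal (?e powr (- \<beta>)) * \<dots> \<le> ennreal (?e powr (- \<beta>)) * ennreal (?m * ?e powr \<alpha>)"
    by (intro mult_left_mono mean) auto
  also have "\<dots> = ennreal (exp (\<kappa> * C) * ?e powr (\<alpha> - \<kappa> - \<beta>))"
  proof -
    have "?m = exp (\<kappa> * C) * ?e powr (- \<kappa>)"
      using n by (simp add: distrib_left exp_add powr_def ln_div)
    then have "?e powr (- \<beta>) * (?m * ?e powr \<alpha>) = exp (\<kappa> * C) * (?e powr (- \<kappa>) * ?e powr (- \<beta>) * ?e powr \<alpha>)"
      by simp
    also have "?e powr (- \<kappa>) * ?e powr (- \<beta>) * ?e powr \<alpha> = ?e powr (\<alpha> - \<kappa> - \<beta>)"
      by (simp flip: powr_add add: algebra_simps)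
    finally show ?thesis by (simp add: ennreal_mult'[symmetric])
  qed
  finally show ?thesis unfolding eq by (simp add: emeasure_eq_measure)
qed

text \<open>
  The crossing event for \<open>\<xi>'\<close> has the same probability for \<open>h\<close> as for \<open>a * h\<^sub>1 + b * h\<^sub>2\<close> on the product
  space. If the first coordinate lies in the crossing event for \<open>\<xi>\<close>, then \<open>fresh_noise_cost\<close> bounds from below the
  probability of the slice over it, and integration over the first coordinate needs no
  measurable choice of a path.
\<close>

lemma likely_rotation:
  assumes \<xi>: "crossing_likely M h k \<xi> \<alpha>" and le: "0 \<le> \<xi>" "\<xi> < \<xi>'"
    and \<beta>: "\<beta> < \<alpha> - (\<xi>'\<^sup>2 - \<xi>\<^sup>2) / 2"
  shows "crossing_likely M h k \<xi>' \<beta>"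
proof -
  define a where "a = \<xi> / \<xi>'"
  define b where "b = sqrt (1 - a\<^sup>2)"
  define \<kappa> where "\<kappa> = (\<xi>' * b)\<^sup>2 / 2"
  have a: "0 \<le> a" "a < 1" "\<xi> = \<xi>' * a" using le by (auto simp: a_def)
  have "a\<^sup>2 \<le> 1" using a by (simp add: power_le_one)
  then have b2: "b\<^sup>2 = 1 - a\<^sup>2" by (simp add: b_def)
  then have ab: "a\<^sup>2 + b\<^sup>2 = 1" by simp
  have \<kappa>_eq: "\<kappa> = (\<xi>'\<^sup>2 - \<xi>\<^sup>2) / 2"
    unfolding \<kappa>_def power_mult_distrib b2 a(3) by (simp add: algebra_simps)
  define \<delta> where "\<delta> = (\<lambda>n::nat. exp (\<kappa> * C) * (1 / real n) powr (\<alpha> - \<kappa> - \<beta>))"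
  have \<delta>: "\<delta> \<longlonglongrightarrow> 0"
  proof -
    have "0 < \<alpha> - \<kappa> - \<beta>" using \<beta> by (simp add: \<kappa>_eq)
    then show ?thesis unfolding \<delta>_def by real_asymp
  qed
  interpret P: pair_prob_space M M ..
  have step: "measure M (crossing_event M h k \<xi> \<alpha> n) - \<delta> n \<le> measure M (crossing_event M h k \<xi>' \<beta> n)" if n: "0 < n" for n
  proof -
    let ?e = "1 / real n"
    define \<rho> where "\<rho> = (\<lambda>x :: real ^ 'n. (box_measure ?e x, uniform_sphere :: (real ^ 'n) measure))"
    \<comment> \<open>The process is indexed by signed measures, so the finite index set of the joint law consists of these
      rather than of lattice points.\<close>
    define F where "F = \<rho> ` lattice_cube ?e"
    have F: "finite F" "F \<subseteq> mass_zero_finite_energy"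
      using lattice_cube_finite_card(1)[OF n] index_cube(1)[OF n] by (auto simp: F_def \<rho>_def)
    let ?Pi = "Pi\<^sub>M F (\<lambda>_. borel :: real measure)"
    define E where "E = {f\<in>space ?Pi. \<exists>P\<in>crossing_paths k ?e. lfpp_length ?e \<xi>' (\<lambda>x. f (\<rho> x)) P \<le> ?e powr \<beta>}"
    have E [measurable]: "E \<in> sets ?Pi"
    proof -
      have "E = (\<Union>P\<in>crossing_paths k ?e. {f\<in>space ?Pi. lfpp_length ?e \<xi>' (\<lambda>x. f (\<rho> x)) P \<le> ?e powr \<beta>})"
        by (auto simp: E_def)
      also have "\<dots> \<in> sets ?Pi"
      proof (intro sets.countable_UN'' countable_crossing_paths n borel_measurable_le)
        fix P assume "P \<in> crossing_paths k ?e"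
        then have "\<rho> x \<in> F" if "x \<in> set P" for x
          using that crossing_path_subset unfolding F_def by blast
        then show "(\<lambda>f. lfpp_length ?e \<xi>' (\<lambda>x. f (\<rho> x)) P) \<in> borel_measurable ?Pi"
          unfolding lfpp_length_def
          by (intro sum_list_measurable borel_measurable_times borel_measurable_const
              measurable_compose[OF _ borel_measurable_exp] measurable_component_singleton)
      qed simp
      finally show ?thesis .
    qed
    have hF: "h r \<in> borel_measurable M" if "r \<in> F" for r
      by (rule field_measurable[OF field]) (use F that in blast)
    have single: "(\<lambda>\<omega>. \<lambda>r\<in>F. h r \<omega>) \<in> measurable M ?Pi" by (intro measurable_restrict hF)
    have double: "(\<lambda>\<omega>. \<lambda>r\<in>F. a * h r (fst \<omega>) + b * h r (snd \<omega>)) \<in> measurable (M \<Otimes>\<^sub>M M) ?Pi"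
      using hF by (intro measurable_restrict borel_measurable_add borel_measurable_times borel_measurable_const)
        (auto intro: measurable_compose[OF measurable_fst] measurable_compose[OF measurable_snd])
    have cong: "lfpp_length ?e \<xi>' (\<lambda>x. (\<lambda>r\<in>F. f r) (\<rho> x)) P = lfpp_length ?e \<xi>' (\<lambda>x. f (\<rho> x)) P"
      if "P \<in> crossing_paths k ?e" for f P
      unfolding lfpp_length_def
      by (intro arg_cong[of _ _ sum_list] map_cong refl)
        (use crossing_path_subset[OF that] in \<open>auto simp: F_def\<close>)
    have E_mem: "(\<lambda>r\<in>F. f r) \<in> E \<longleftrightarrow> (\<exists>P\<in>crossing_paths k ?e. lfpp_length ?e \<xi>' (\<lambda>x. f (\<rho> x)) P \<le> ?e powr \<beta>)" for f
    proof -
      have "(\<lambda>r\<in>F. f r) \<in> space ?Pi" by (simp add: space_PiM)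
      then show ?thesis unfolding E_def by (simp only: mem_Collect_eq simp_thms cong cong: bex_cong)
    qed
    have average: "box_average h ?e \<omega> = (\<lambda>x. h (\<rho> x) \<omega>)" for \<omega>
      by (simp add: fun_eq_iff box_average_eq \<rho>_def)
    define G where "G = {\<omega>\<in>space (M \<Otimes>\<^sub>M M). \<exists>P\<in>crossing_paths k ?e.
      lfpp_length ?e \<xi>' (\<lambda>x. a * h (\<rho> x) (fst \<omega>) + b * h (\<rho> x) (snd \<omega>)) P \<le> ?e powr \<beta>}"
    have "(\<lambda>\<omega>. \<lambda>r\<in>F. h r \<omega>) -` E \<inter> space M = crossing_event M h k \<xi>' \<beta> n"
      unfolding crossing_event_def average by (auto simp only: vimage_def E_mem)
    then have 1: "measure M (crossing_event M h k \<xi>' \<beta> n) = measure (distr M ?Pi (\<lambda>\<omega>. \<lambda>r\<in>F. h r \<omega>)) E"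
      using measure_distr[OF single E] by simp
    have G_eq: "(\<lambda>\<omega>. \<lambda>r\<in>F. a * h r (fst \<omega>) + b * h r (snd \<omega>)) -` E \<inter> space (M \<Otimes>\<^sub>M M) = G"
      unfolding G_def by (auto simp only: vimage_def E_mem)
    then have G [measurable]: "G \<in> sets (M \<Otimes>\<^sub>M M)" using measurable_sets[OF double E] by simp
    have "measure M (crossing_event M h k \<xi>' \<beta> n) = measure (M \<Otimes>\<^sub>M M) G"
      unfolding 1 field_rotation_invariance[OF field F ab]
      using measure_distr[OF double E] G_eq by simp
    then have rot: "ennreal (measure M (crossing_event M h k \<xi>' \<beta> n)) = emeasure (M \<Otimes>\<^sub>M M) G"
      by (simp add: P.emeasure_eq_measure)
    have slice: "1 - \<delta> n \<le> measure M (Pair \<omega> -` G)" if w: "\<omega> \<in> crossing_event M h k \<xi> \<alpha> n" for \<omega>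
    proof -
      obtain P where w: "\<omega> \<in> space M" and P: "P \<in> crossing_paths k ?e"
        and len: "lfpp_length ?e \<xi> (box_average h ?e \<omega>) P \<le> ?e powr \<alpha>"
        using w by (auto simp: crossing_event_def)
      let ?bad = "{\<omega>'\<in>space M. \<not> lfpp_length ?e \<xi>' (\<lambda>x. a * box_average h ?e \<omega> x + b * box_average h ?e \<omega>' x) P \<le> ?e powr \<beta>}"
      have "space M - Pair \<omega> -` G \<subseteq> ?bad"
        using w P unfolding average by (auto simp: G_def space_pair_measure)
      moreover have "?bad \<in> sets M"
      proof -
        have "(\<lambda>\<omega>'. lfpp_length ?e \<xi>' (\<lambda>x. a * box_average h ?e \<omega> x + b * box_average h ?e \<omega>' x) P) \<in> borel_measurable M"
          unfolding lfpp_length_def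
          using box_average_measurable[OF n] crossing_path_subset[OF P]
          by (intro sum_list_measurable borel_measurable_times borel_measurable_const
              measurable_compose[OF _ borel_measurable_exp] borel_measurable_add) auto
        then show ?thesis by measurable
      qed
      ultimately have "measure M (space M - Pair \<omega> -` G) \<le> measure M ?bad"
        by (rule finite_measure_mono)
      also have "\<dots> \<le> \<delta> n"
        unfolding \<delta>_def by (rule fresh_noise_cost[OF n P a(3) len \<kappa>_def])
      finally have "measure M (space M - Pair \<omega> -` G) \<le> \<delta> n" .
      moreover have "Pair \<omega> -` G \<in> sets M" by (rule sets_Pair1[OF G])
      ultimately show ?thesis by (simp add: prob_compl)
    qed
    have X: "crossing_event M h k \<xi> \<alpha> n \<in> sets M" by (rule crossing_event_sets[OF n])
    have "ennreal ((1 - \<delta> n) * measure M (crossing_event M h k \<xi> \<alpha> n)) =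
        ennreal (1 - \<delta> n) * emeasure M (crossing_event M h k \<xi> \<alpha> n)"
      by (simp add: emeasure_eq_measure ennreal_mult'')
    also have "\<dots> = (\<integral>\<^sup>+\<omega>. ennreal (1 - \<delta> n) * indicator (crossing_event M h k \<xi> \<alpha> n) \<omega> \<partial>M)"
      using X by (simp add: nn_integral_cmult_indicator)
    also have "\<dots> \<le> (\<integral>\<^sup>+\<omega>. emeasure M (Pair \<omega> -` G) \<partial>M)"
      using slice by (intro nn_integral_mono) (auto simp: emeasure_eq_measure indicator_def intro!: ennreal_leI)
    also have "\<dots> = emeasure (M \<Otimes>\<^sub>M M) G" by (rule emeasure_pair_measure_alt[OF G, symmetric])
    finally have "(1 - \<delta> n) * measure M (crossing_event M h k \<xi> \<alpha> n) \<le> measure M (crossing_event M h k \<xi>' \<beta> n)"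
      unfolding rot[symmetric] by (subst (asm) ennreal_le_iff) auto
    moreover have "\<delta> n * measure M (crossing_event M h k \<xi> \<alpha> n) \<le> \<delta> n * 1"
      by (intro mult_left_mono) (auto simp: \<delta>_def)
    ultimately show ?thesis by (simp add: algebra_simps)
  qed
  show ?thesis
    unfolding crossing_likely_def
  proof (rule prob_tendsto_1_mono[OF prob_space_axioms _ \<delta>])
    show "(\<lambda>n. measure M (crossing_event M h k \<xi> \<alpha> n)) \<longlonglongrightarrow> 1" using \<xi> by (simp add: crossing_likely_def)
    show "\<forall>\<^sub>F n in sequentially. measure M (crossing_event M h k \<xi> \<alpha> n) - \<delta> n \<le> measure M (crossing_event M h k \<xi>' \<beta> n)"
      using eventually_gt_at_top[of 0] by eventually_elim (rule step)
  qed
qed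

end

section \<open>The distance exponent as a real function of \<open>\<xi>\<close>\<close>

context lfpp
begin

text \<open>
  This is the distance exponent as a real number. The supremum is over a nonempty set that is bounded above,
  because every \<open>\<xi>\<close> can be compared with \<open>\<xi> = 0\<close>.
\<close>

definition crossing_exponent :: "real \<Rightarrow> real" where
  "crossing_exponent \<xi> = Sup {\<alpha>. crossing_likely M h k \<xi> \<alpha>}"

lemma likely_le:
  assumes "crossing_likely M h k \<xi> \<alpha>" "sqrt (2 * real CARD('n)) < c"
  shows "\<alpha> \<le> \<bar>\<xi>\<bar> * c"
proof (rule ccontr)
  assume "\<not> \<alpha> \<le> \<bar>\<xi>\<bar> * c"
  then show False
    using likely_shift[OF assms, of 0] not_likely_zero_pos[of "\<alpha> - \<bar>\<xi>\<bar> * c"] by simp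
qed

lemma likely_nonempty_bdd:
  "{\<alpha>. crossing_likely M h k \<xi> \<alpha>} \<noteq> {}" "bdd_above {\<alpha>. crossing_likely M h k \<xi> \<alpha>}"
proof -
  obtain c where c: "sqrt (2 * real CARD('n)) < c" using gt_ex by blast
  show "{\<alpha>. crossing_likely M h k \<xi> \<alpha>} \<noteq> {}"
    using likely_shift[OF likely_zero_neg[of "-1"] c, of \<xi>] by auto
  show "bdd_above {\<alpha>. crossing_likely M h k \<xi> \<alpha>}"
    using likely_le[OF _ c] by (intro bdd_aboveI[of _ "\<bar>\<xi>\<bar> * c"]) simp
qed

lemma likely_le_crossing_exponent: "crossing_likely M h k \<xi> \<alpha> \<Longrightarrow> \<alpha> \<le> crossing_exponent \<xi>"
  unfolding crossing_exponent_def by (intro cSup_upper likely_nonempty_bdd) simp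

lemma likely_below_crossing_exponent:
  assumes "\<alpha> < crossing_exponent \<xi>"
  shows "crossing_likely M h k \<xi> \<alpha>"
  using less_cSupD[OF likely_nonempty_bdd(1) assms[unfolded crossing_exponent_def]] crossing_likely_antimono
  by (auto intro: less_imp_le)

lemma distance_exponent_eq: "distance_exponent M h k \<xi> = ereal (crossing_exponent \<xi>)"
  unfolding distance_exponent_eq_Sup_likely
proof (rule antisym)
  show "Sup (ereal ` {\<alpha>. crossing_likely M h k \<xi> \<alpha>}) \<le> ereal (crossing_exponent \<xi>)"
    using likely_le_crossing_exponent by (intro SUP_least) auto
  show "ereal (crossing_exponent \<xi>) \<le> Sup (ereal ` {\<alpha>. crossing_likely M h k \<xi> \<alpha>})"
  proof (rule dense_le)
    fix y assume "y < ereal (crossing_exponent \<xi>)"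
    then obtain \<beta> where \<beta>: "y < ereal \<beta>" "ereal \<beta> < ereal (crossing_exponent \<xi>)" using ereal_dense2 by blast
    then have "ereal \<beta> \<le> Sup (ereal ` {\<alpha>. crossing_likely M h k \<xi> \<alpha>})"
      by (intro SUP_upper) (simp add: likely_below_crossing_exponent)
    then show "y \<le> Sup (ereal ` {\<alpha>. crossing_likely M h k \<xi> \<alpha>})" using \<beta>(1) by simp
  qed
qed

lemma crossing_exponent_zero: "crossing_exponent 0 = 0"
proof (rule antisym)
  show "crossing_exponent 0 \<le> 0"
    using likely_below_crossing_exponent[of _ 0] not_likely_zero_pos dense[of 0 "crossing_exponent 0"]
    by (meson not_le)
  show "0 \<le> crossing_exponent 0"
    by (rule dense_le) (intro likely_le_crossing_exponent likely_zero_neg)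
qed

lemma crossing_exponent_lipschitz:
  "\<bar>crossing_exponent \<xi>' - crossing_exponent \<xi>\<bar> \<le> sqrt (2 * real CARD('n)) * \<bar>\<xi>' - \<xi>\<bar>"
proof -
  have one_sided: "crossing_exponent \<xi> - \<bar>\<xi>' - \<xi>\<bar> * c \<le> crossing_exponent \<xi>'" if c: "sqrt (2 * real CARD('n)) < c" for \<xi> \<xi>' c
  proof (rule dense_le)
    fix \<alpha> assume "\<alpha> < crossing_exponent \<xi> - \<bar>\<xi>' - \<xi>\<bar> * c"
    then have "crossing_likely M h k \<xi> (\<alpha> + \<bar>\<xi>' - \<xi>\<bar> * c)" by (intro likely_below_crossing_exponent) simp
    from likely_le_crossing_exponent[OF likely_shift[OF this c, of \<xi>']] show "\<alpha> \<le> crossing_exponent \<xi>'" by simp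
  qed
  have closed: "crossing_exponent \<xi> - \<bar>\<xi>' - \<xi>\<bar> * sqrt (2 * real CARD('n)) \<le> crossing_exponent \<xi>'" for \<xi> \<xi>'
  proof (rule tendsto_upperbound)
    show "((\<lambda>c. crossing_exponent \<xi> - \<bar>\<xi>' - \<xi>\<bar> * c) \<longlongrightarrow> crossing_exponent \<xi> - \<bar>\<xi>' - \<xi>\<bar> * sqrt (2 * real CARD('n)))
        (at_right (sqrt (2 * real CARD('n))))"
      by (intro tendsto_intros)
    show "\<forall>\<^sub>F c in at_right (sqrt (2 * real CARD('n))). crossing_exponent \<xi> - \<bar>\<xi>' - \<xi>\<bar> * c \<le> crossing_exponent \<xi>'"
      using eventually_at_right_less by eventually_elim (rule one_sided)
  qed simp
  show ?thesis
    using closed[of \<xi> \<xi>'] closed[of \<xi>' \<xi>] by (simp add: abs_le_iff abs_minus_commute mult.commute)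
qed

lemma crossing_exponent_rotation:
  assumes "0 \<le> \<xi>" "\<xi> \<le> \<xi>'"
  shows "crossing_exponent \<xi> + \<xi>\<^sup>2 / 2 \<le> crossing_exponent \<xi>' + \<xi>'\<^sup>2 / 2"
proof (cases "\<xi> = \<xi>'")
  case False
  then have less: "\<xi> < \<xi>'" using assms by simp
  have "crossing_exponent \<xi> - (\<xi>'\<^sup>2 - \<xi>\<^sup>2) / 2 \<le> crossing_exponent \<xi>'"
  proof (rule dense_le)
    fix \<beta> assume "\<beta> < crossing_exponent \<xi> - (\<xi>'\<^sup>2 - \<xi>\<^sup>2) / 2"
    then have "\<beta> + (\<xi>'\<^sup>2 - \<xi>\<^sup>2) / 2 < crossing_exponent \<xi>" by simp
    from dense[OF this] obtain \<alpha> where \<alpha>: "\<beta> + (\<xi>'\<^sup>2 - \<xi>\<^sup>2) / 2 < \<alpha>" "\<alpha> < crossing_exponent \<xi>" by blast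
    have "crossing_likely M h k \<xi>' \<beta>"
      by (rule likely_rotation[OF likely_below_crossing_exponent[OF \<alpha>(2)] assms(1) less]) (use \<alpha>(1) in simp)
    then show "\<beta> \<le> crossing_exponent \<xi>'" by (rule likely_le_crossing_exponent)
  qed
  then show ?thesis by (simp add: diff_divide_distrib)
qed simp

end

theorem proposition1p8:
  fixes M :: "'w measure"
    and h :: "(real ^ 'n) signed_pair \<Rightarrow> 'w \<Rightarrow> real"
    and k :: 'n
    and I :: "real set"
    and Q :: "real \<Rightarrow> real"
  assumes dim: "CARD('n) \<ge> 3"
    and field: "log_correlated_field M h"
  defines "I \<equiv> {0 <..< sqrt (2 * real CARD('n))}"
    and "Q \<equiv> \<lambda>\<gamma>. real CARD('n) / \<gamma> + \<gamma> / 2"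
  shows "(\<forall>\<gamma>\<in>I. \<exists>!\<delta>::real. 0 < \<delta> \<and>
            distance_exponent M h k (\<gamma> / \<delta>) = ereal (1 - \<gamma> / \<delta> * Q \<gamma>)) \<and>
         (\<forall>D :: real \<Rightarrow> real.
            (\<forall>\<gamma>\<in>I. 0 < D \<gamma> \<and>
               distance_exponent M h k (\<gamma> / D \<gamma>) = ereal (1 - \<gamma> / D \<gamma> * Q \<gamma>)) \<longrightarrow>
            continuous_on I (\<lambda>\<gamma>. \<gamma> / D \<gamma>) \<and> strict_mono_on I (\<lambda>\<gamma>. \<gamma> / D \<gamma>) \<and>
            continuous_on I D \<and> strict_mono_on I D)"
proof -
  have "2 \<le> CARD('n)" using dim by simp
  then obtain C where "0 < C"
    "\<And>\<epsilon> (x :: real ^ 'n). 0 < \<epsilon> \<Longrightarrow> \<epsilon> \<le> 1 \<Longrightarrow> x \<in> cbox 0 (vec 1) \<Longrightarrow>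
      (box_measure \<epsilon> x, uniform_sphere) \<in> mass_zero_finite_energy \<and>
      log_covariance (box_measure \<epsilon> x, uniform_sphere) (box_measure \<epsilon> x, uniform_sphere) \<le> ln (1 / \<epsilon>) + C"
    using box_average_index[where 'n = 'n] by blast
  then interpret lfpp M h k C
    using field by unfold_locales
  have d: "1 < real CARD('n)" using dim by simp
  have lip: "\<bar>crossing_exponent y - crossing_exponent x\<bar> \<le> sqrt (2 * real CARD('n)) * (y - x)" if "0 \<le> x" "x \<le> y" for x y
    using crossing_exponent_lipschitz[of y x] that by simp
  have part1: "\<exists>!\<delta>. 0 < \<delta> \<and> crossing_exponent (\<gamma> / \<delta>) = 1 - \<gamma> / \<delta> * Q \<gamma>" if "\<gamma> \<in> I" for \<gamma>
    unfolding Q_def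
    by (rule exponent_relation_analysis(1)[OF d crossing_exponent_zero lip crossing_exponent_rotation])
      (use that in \<open>simp_all add: I_def\<close>)
  have part2: "continuous_on I (\<lambda>\<gamma>. \<gamma> / D \<gamma>) \<and> strict_mono_on I (\<lambda>\<gamma>. \<gamma> / D \<gamma>) \<and> continuous_on I D \<and> strict_mono_on I D"
    if "\<forall>\<gamma>\<in>I. 0 < D \<gamma> \<and> crossing_exponent (\<gamma> / D \<gamma>) = 1 - \<gamma> / D \<gamma> * Q \<gamma>" for D
    unfolding I_def
    by (rule exponent_relation_analysis(2)[OF d crossing_exponent_zero lip crossing_exponent_rotation])
      (use that in \<open>simp_all add: I_def Q_def\<close>)
  show ?thesis
    unfolding distance_exponent_eq ereal.inject
    by (rule conjI, rule ballI, erule part1, intro allI impI, erule part2)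
qed

end
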